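(* Let $r\ge1$ and $k=m_0>m_1>\dots>m_r>m_{r+1}=0$ be integers, and put $d_{ij}=m_i-m_j$. Then $$\bigl(1-xR_{d_{01}-1}(x)-xR_{m_r}(x)\bigr)G_{[m_0,\dots,m_r]}(x)=x\,G_{[d_{01}-1]}^{[d_{02},d_{12}]}(x)\,G^{[m_0,\dots,m_r]}_{[m_1,\dots,m_r]}(x)+x\sum_{j=2}^rG_{[d_{0j},\dots,d_{j-1,j}]}^{[d_{0,j+1},\dots,d_{j,j+1}]}(x)\,G^{[m_{j-1},\dots,m_r]}_{[m_j,\dots,m_r]}(x).$$
   Context: An occurrence of a pattern $\tau\in S_k$ in $\alpha\in S_n$ is a choice of indices $1\le i_1<\dots<i_k\le n$ with $(\alpha_{i_1},\dots,\alpha_{i_k})$ order-isomorphic to $\tau$; $\alpha$ contains $\tau$ exactly once if there is exactly one occurrence, and avoids $\tau$ if there is none. $g_\tau(n)$ is the number of permutations in $S_n$ that avoid $132$ and contain $\tau$ exactly once; $g^\rho_\tau(n)$ is the number of permutations in $S_n$ that avoid both $132$ and $\rho$ and contain $\tau$ exactly once; $G_\tau(x)=\sum_{n\ge0}g_\tau(n)x^n$ and $G_\tau^\rho(x)=\sum_{n\ge0}g_\tau^\rho(n)x^n$. Layered patterns: for integers $p_0>p_1>\dots>p_q>p_{q+1}=0$, $[p_0,\dots,p_q]$ is the permutation of $\{1,\dots,p_0\}$ obtained by concatenating the increasing blocks $(p_{i+1}+1,\dots,p_i)$, $i=0,\dots,q$; in particular $[p]=(1,2,\dots,p)$ and $[0]$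 is the empty pattern. Convention: $G^\rho_{[0]}(x)=1$ for the empty pattern $[0]$. $U_p$ is the Chebyshev polynomial of the second kind, $U_p(\cos\theta)=\sin((p+1)\theta)/\sin\theta$, $U_{-1}=0$, and for $p\ge0$, $R_p(x)=\dfrac{U_{p-1}\left(\frac1{2\sqrt x}\right)}{\sqrt x\,U_p\left(\frac1{2\sqrt x}\right)}$ (so $R_0=0$). *)

theory Defs
  imports
    Complex_Main
    "HOL-Combinatorics.Multiset_Permutations"
    "HOL-Computational_Algebra.Computational_Algebra"
begin

text \<open>Permutations of \<open>{1..n}\<close> and patterns are written in one-line notation, as lists of
  naturals; the permutations in \<open>S_n\<close> are the elements of \<^term>\<open>permutations_of_set {1..n}\<close>.\<close>

definition order_isomorphic :: "nat list \<Rightarrow> nat list \<Rightarrow> bool" where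
  "order_isomorphic xs ys \<longleftrightarrow> length xs = length ys \<and>
     (\<forall>i < length xs. \<forall>j < length xs. xs ! i < xs ! j \<longleftrightarrow> ys ! i < ys ! j)"

text \<open>An occurrence is recorded as its increasing list of indices, counted from 0.\<close>

definition occurrences :: "nat list \<Rightarrow> nat list \<Rightarrow> nat list set" where
  "occurrences \<tau> \<alpha> = {js. sorted_wrt (<) js \<and> set js \<subseteq> {..<length \<alpha>} \<and>
     order_isomorphic (map (\<lambda>i. \<alpha> ! i) js) \<tau>}"

definition avoids :: "nat list \<Rightarrow> nat list \<Rightarrow> bool" where
  "avoids \<tau> \<alpha> \<longleftrightarrow> occurrences \<tau> \<alpha> = {}"

definition contains_once :: "nat list \<Rightarrow> nat list \<Rightarrow> bool" where
  "contains_once \<tau> \<alpha> \<longleftrightarrow> card (occurrences \<tau> \<alpha>) = 1"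

definition g :: "nat list \<Rightarrow> nat \<Rightarrow> nat" where
  "g \<tau> n = card {\<alpha> \<in> permutations_of_set {1..n}. avoids [1,3,2] \<alpha> \<and> contains_once \<tau> \<alpha>}"

definition g_avoid :: "nat list \<Rightarrow> nat list \<Rightarrow> nat \<Rightarrow> nat" where
  "g_avoid \<rho> \<tau> n = card {\<alpha> \<in> permutations_of_set {1..n}.
     avoids [1,3,2] \<alpha> \<and> avoids \<rho> \<alpha> \<and> contains_once \<tau> \<alpha>}"

definition G :: "nat list \<Rightarrow> real fps" where
  "G \<tau> = Abs_fps (\<lambda>n. of_nat (g \<tau> n))"

text \<open>The value 1 at the empty pattern is a convention: it is not the generating function of
  \<^term>\<open>g_avoid \<rho> []\<close>, the empty pattern having exactly one occurrence in every permutation.\<close>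

definition G_avoid :: "nat list \<Rightarrow> nat list \<Rightarrow> real fps" where
  "G_avoid \<rho> \<tau> = (if \<tau> = [] then 1 else Abs_fps (\<lambda>n. of_nat (g_avoid \<rho> \<tau> n)))"

text \<open>\<open>layered [p\<^sub>0, \<dots>, p\<^sub>q]\<close> is the layered pattern \<open>[p\<^sub>0, \<dots>, p\<^sub>q]\<close>, where the final \<open>p\<^bsub>q+1\<^esub> = 0\<close>
  is left implicit; \<open>layered [0]\<close> is the empty pattern.\<close>

fun layered :: "nat list \<Rightarrow> nat list" where
  "layered [] = []"
| "layered [p] = [1..<Suc p]"
| "layered (p # p' # ps) = [Suc p'..<Suc p] @ layered (p' # ps)"

text \<open>The index is an integer so that \<open>U\<^bsub>-1\<^esub> = 0\<close> is covered.\<close>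

definition chebyshev_U :: "int \<Rightarrow> real poly" where
  "chebyshev_U p = (THE P. \<forall>\<theta>. sin \<theta> \<noteq> 0 \<longrightarrow>
     poly P (cos \<theta>) = sin ((of_int p + 1) * \<theta>) / sin \<theta>)"

text \<open>With \<open>t = \<surd>x\<close> as the variable of the field of formal Laurent series, this is
  \<open>U\<^sub>p(1/(2\<surd>x))\<close>.\<close>

definition U_laurent :: "int \<Rightarrow> real fls" where
  "U_laurent p = poly (map_poly fls_const (chebyshev_U p)) (1 / (2 * fls_X))"

text \<open>\<open>R p\<close> is the power series in \<open>x\<close> which after substituting \<open>x = t\<^sup>2\<close> becomes
  \<open>U\<^bsub>p-1\<^esub>(1/(2t)) / (t U\<^sub>p(1/(2t)))\<close>; see \<open>R_spec\<close> and \<open>R_unique\<close> below.\<close>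

definition R :: "nat \<Rightarrow> real fps" where
  "R p = (THE F. fps_to_fls (F oo fps_X ^ 2) =
     U_laurent (int p - 1) / (fls_X * U_laurent (int p)))"


subsection \<open>The definite descriptions are well-defined\<close>

lemma chebyshev_U_unique:
  fixes P Q :: "real poly"
  assumes "\<And>\<theta>. sin \<theta> \<noteq> 0 \<Longrightarrow> poly P (cos \<theta>) = f \<theta>"
    and "\<And>\<theta>. sin \<theta> \<noteq> 0 \<Longrightarrow> poly Q (cos \<theta>) = f \<theta>"
  shows "P = Q"
proof -
  have "poly (P - Q) x = 0" if "x \<in> {-1<..<1}" for x
  proof -
    have "sin (arccos x) \<noteq> 0" "cos (arccos x) = x"
      using that sin_arccos_nonzero[of x] by (auto intro: cos_arccos)
    then show ?thesis using assms[of "arccos x"] by simp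
  qed
  then have "{-1<..<1} \<subseteq> {x. poly (P - Q) x = 0}" by blast
  moreover have "infinite {-1<..<1::real}" by (rule infinite_Ioo) simp
  ultimately have "P - Q = 0" using poly_roots_finite finite_subset by blast
  then show ?thesis by simp
qed

lemma chebyshev_U_eqI:
  assumes "\<And>\<theta>. sin \<theta> \<noteq> 0 \<Longrightarrow> poly P (cos \<theta>) = sin ((of_int p + 1) * \<theta>) / sin \<theta>"
  shows "chebyshev_U p = P"
  unfolding chebyshev_U_def
proof (rule the_equality)
  show "\<forall>\<theta>. sin \<theta> \<noteq> 0 \<longrightarrow> poly P (cos \<theta>) = sin ((of_int p + 1) * \<theta>) / sin \<theta>"
    using assms by blast
next
  fix Q :: "real poly"
  assume "\<forall>\<theta>. sin \<theta> \<noteq> 0 \<longrightarrow> poly Q (cos \<theta>) = sin ((of_int p + 1) * \<theta>) / sin \<theta>"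
  then show "Q = P" using chebyshev_U_unique[OF _ assms] by blast
qed

lemma sin_Suc_Suc:
  "sin ((a + 2) * \<theta>) = 2 * cos \<theta> * sin ((a + 1) * \<theta>) - sin (a * \<theta>)" for a \<theta> :: real
proof -
  have "sin ((a + 1) * \<theta> + \<theta>) + sin ((a + 1) * \<theta> - \<theta>) = 2 * cos \<theta> * sin ((a + 1) * \<theta>)"
    by (simp add: sin_add sin_diff)
  then show ?thesis by (simp add: algebra_simps)
qed

lemma chebyshev_U_minus_one: "chebyshev_U (-1) = 0"
  by (rule chebyshev_U_eqI) simp

lemma chebyshev_U_zero: "chebyshev_U 0 = 1"
  by (rule chebyshev_U_eqI) simp

lemma chebyshev_U_exists:
  "\<exists>P. \<forall>\<theta>. sin \<theta> \<noteq> 0 \<longrightarrow> poly P (cos \<theta>) = sin (real n * \<theta>) / sin \<theta>"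
proof (induction n rule: induct_nat_012)
  case 0
  show ?case by (rule exI[of _ 0]) simp
next
  case 1
  show ?case by (rule exI[of _ 1]) simp
next
  case (ge2 n)
  then obtain P Q where
    P: "\<And>\<theta>. sin \<theta> \<noteq> 0 \<Longrightarrow> poly P (cos \<theta>) = sin (real n * \<theta>) / sin \<theta>" and
    Q: "\<And>\<theta>. sin \<theta> \<noteq> 0 \<Longrightarrow> poly Q (cos \<theta>) = sin (real (Suc n) * \<theta>) / sin \<theta>"
    by blast
  have "poly ([:0, 2:] * Q - P) (cos \<theta>) = sin (real (Suc (Suc n)) * \<theta>) / sin \<theta>"
    if "sin \<theta> \<noteq> 0" for \<theta>
    using sin_Suc_Suc[of "real n" \<theta>] P[OF that] Q[OF that]
    by (simp add: diff_divide_distrib add.commute)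
  then show ?case by blast
qed

lemma poly_chebyshev_U:
  assumes "p \<ge> -1" "sin \<theta> \<noteq> 0"
  shows "poly (chebyshev_U p) (cos \<theta>) = sin ((of_int p + 1) * \<theta>) / sin \<theta>"
proof -
  have *: "real (nat (p + 1)) = of_int p + 1" using assms(1) by simp
  obtain P where P: "\<forall>\<theta>::real. sin \<theta> \<noteq> 0 \<longrightarrow> poly P (cos \<theta>) = sin ((of_int p + 1) * \<theta>) / sin \<theta>"
    using chebyshev_U_exists[of "nat (p + 1)"] unfolding * by blast
  then have "chebyshev_U p = P" by (intro chebyshev_U_eqI) blast
  with P assms(2) show ?thesis by simp
qed

lemma chebyshev_U_rec:
  assumes "p \<ge> 0"
  shows "chebyshev_U (p + 1) = [:0, 2:] * chebyshev_U p - chebyshev_U (p - 1)"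
proof (rule chebyshev_U_eqI)
  fix \<theta> :: real assume \<theta>: "sin \<theta> \<noteq> 0"
  show "poly ([:0, 2:] * chebyshev_U p - chebyshev_U (p - 1)) (cos \<theta>) =
      sin ((of_int (p + 1) + 1) * \<theta>) / sin \<theta>"
    using poly_chebyshev_U[of p \<theta>] poly_chebyshev_U[of "p - 1" \<theta>] sin_Suc_Suc[of "of_int p" \<theta>] assms \<theta>
    by (simp add: diff_divide_distrib add.assoc)
qed

lemma U_laurent_minus_one: "U_laurent (-1) = 0"
  by (simp add: U_laurent_def chebyshev_U_minus_one)

lemma U_laurent_zero: "U_laurent 0 = 1"
  by (simp add: U_laurent_def chebyshev_U_zero)

lemma U_laurent_rec:
  assumes "p \<ge> 0"
  shows "fls_X * U_laurent (p + 1) = U_laurent p - fls_X * U_laurent (p - 1)"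
proof -
  let ?h = "map_poly (fls_const :: real \<Rightarrow> real fls)"
  let ?s = "1 / (2 * fls_X) :: real fls"
  have diff: "?h (P - Q) = ?h P - ?h Q" for P Q
    by (rule poly_eqI) (simp add: coeff_map_poly fls_minus_const)
  have X: "2 * fls_X \<noteq> (0 :: real fls)" by simp
  have "?h (pCons 0 (smult 2 P)) = pCons 0 (smult 2 (?h P))" for P
    by (simp add: map_poly_pCons map_poly_smult)
  then have "U_laurent (p + 1) = ?s * (2 * U_laurent p) - U_laurent (p - 1)"
    unfolding U_laurent_def chebyshev_U_rec[OF assms] diff poly_diff by simp
  then have "fls_X * U_laurent (p + 1) = (2 * fls_X * ?s) * U_laurent p - fls_X * U_laurent (p - 1)"
    by (simp only: right_diff_distrib mult_ac)
  also have "2 * fls_X * ?s = 1"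
    using nonzero_eq_divide_eq[OF X, of ?s 1] by (metis mult.commute)
  finally show ?thesis by simp
qed

lemma R_unique:
  fixes F H :: "real fps"
  assumes "fps_to_fls (F oo fps_X ^ 2) = fps_to_fls (H oo fps_X ^ 2)"
  shows "F = H"
proof -
  have "(F - H) oo fps_X ^ 2 = 0"
    using assms by (simp add: fps_compose_sub_distrib)
  then have "F - H = 0"
    by (subst (asm) fps_compose_eq_0_iff) auto
  then show ?thesis by simp
qed

lemma U_laurent_nonzero_and_R_exists:
  "U_laurent (int p) \<noteq> 0 \<and> (\<exists>F. fps_to_fls (F oo fps_X ^ 2) =
     U_laurent (int p - 1) / (fls_X * U_laurent (int p)))"
proof (induction p)
  case 0
  have "fps_to_fls (0 oo fps_X ^ 2) = U_laurent (int 0 - 1) / (fls_X * U_laurent (int 0))"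
    by (simp add: U_laurent_minus_one)
  then show ?case by (metis U_laurent_zero of_nat_0 zero_neq_one)
next
  case (Suc p)
  then obtain F where nz: "U_laurent (int p) \<noteq> 0" and
    F: "fps_to_fls (F oo fps_X ^ 2) = U_laurent (int p - 1) / (fls_X * U_laurent (int p))" by blast
  define D where "D = 1 - fps_X * F"
  have D0: "D $ 0 = 1" by (simp add: D_def)
  have "fps_to_fls (D oo fps_X ^ 2) = 1 - fls_X ^ 2 * fps_to_fls (F oo fps_X ^ 2)"
    by (simp add: D_def fps_compose_sub_distrib fps_compose_mult_distrib fls_times_fps_to_fls
        fps_to_fls_power)
  then have "U_laurent (int p) * fps_to_fls (D oo fps_X ^ 2) = fls_X * U_laurent (int p + 1)"
    using nz unfolding F U_laurent_rec[of "int p", simplified]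
    by (simp add: field_simps power2_eq_square)
  moreover have D_nz: "D oo fps_X ^ 2 \<noteq> 0"
    using D0 by (metis fps_compose_nth_0 fps_zero_nth zero_neq_one)
  ultimately have nz': "U_laurent (int p + 1) \<noteq> 0"
    and eq: "fls_X * U_laurent (int p + 1) = U_laurent (int p) * fps_to_fls (D oo fps_X ^ 2)"
    using nz by auto
  have "inverse D * D = 1" using D0 by (simp add: inverse_mult_eq_1)
  then have "(inverse D oo fps_X ^ 2) * (D oo fps_X ^ 2) = 1"
    by (simp flip: fps_compose_mult_distrib)
  then have "fps_to_fls (inverse D oo fps_X ^ 2) * fps_to_fls (D oo fps_X ^ 2) = 1"
    by (simp flip: fls_times_fps_to_fls)
  then have "fps_to_fls (inverse D oo fps_X ^ 2) = U_laurent (int p) / (fls_X * U_laurent (int p + 1))"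
    using nz nz' by (subst nonzero_eq_divide_eq) (simp_all only: eq mult_ac, use D_nz in simp_all)
  moreover have "int (Suc p) = int p + 1" "int (Suc p) - 1 = int p" by simp_all
  ultimately show ?case using nz' by metis
qed

lemma R_spec:
  "fps_to_fls (R p oo fps_X ^ 2) = U_laurent (int p - 1) / (fls_X * U_laurent (int p))"
  unfolding R_def
proof (rule theI')
  show "\<exists>!F. fps_to_fls (F oo fps_X ^ 2) = U_laurent (int p - 1) / (fls_X * U_laurent (int p))"
    using U_laurent_nonzero_and_R_exists[of p] R_unique by metis
qed

lemma R_zero: "R 0 = 0"
  by (rule R_unique) (simp add: R_spec U_laurent_minus_one)

lemma R_Suc: "R (Suc p) * (1 - fps_X * R p) = 1"
proof -
  have nz: "U_laurent (int p) \<noteq> 0" "U_laurent (int p + 1) \<noteq> 0"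
    using U_laurent_nonzero_and_R_exists[of p] U_laurent_nonzero_and_R_exists[of "Suc p"]
    by (simp_all add: add.commute)
  have "1 - fls_X ^ 2 * fps_to_fls (R p oo fps_X ^ 2) = fls_X * U_laurent (int p + 1) / U_laurent (int p)"
    using nz unfolding R_spec U_laurent_rec[of "int p", simplified]
    by (simp add: field_simps power2_eq_square)
  moreover have "fps_to_fls (R (Suc p) oo fps_X ^ 2) = U_laurent (int p) / (fls_X * U_laurent (int p + 1))"
    using R_spec[of "Suc p"] by (simp add: add.commute)
  ultimately have "fps_to_fls (R (Suc p) oo fps_X ^ 2) * (1 - fls_X ^ 2 * fps_to_fls (R p oo fps_X ^ 2)) = 1"
    using nz by simp
  then have "fps_to_fls ((R (Suc p) * (1 - fps_X * R p)) oo fps_X ^ 2) = fps_to_fls (1 oo fps_X ^ 2)"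
    by (simp add: fps_compose_sub_distrib fps_compose_mult_distrib fls_times_fps_to_fls fps_to_fls_power)
  then show ?thesis by (rule R_unique)
qed

end

theory Submission
  imports Defs
begin

text \<open>A nonempty permutation avoids 132 iff it is \<open>\<beta>' n \<gamma>\<close> with \<open>n\<close> its largest entry, every entry of
  \<open>\<beta>'\<close> larger than every entry of \<open>\<gamma>\<close>, and \<open>\<beta>'\<close>, \<open>\<gamma>\<close> avoiding 132. An occurrence of a layered
  pattern in it is cut by this decomposition between two layers, and \<open>n\<close> can only be used as the last
  letter of the first layer when the cut comes right after that layer. So the number of occurrences
  is \<open>\<Sum>\<^sub>j N\<^sub>j(\<beta>') M\<^sub>j(\<gamma>)\<close>, where \<open>N\<^sub>j\<close> counts the first \<open>j\<close> layers in \<open>\<beta>' n\<close> and \<open>M\<^sub>j\<close> the remaining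
  ones in \<open>\<gamma>\<close>. For the sum to be 1, exactly one term is 1; the term with index \<open>j\<close> contributes the
  product of generating functions for \<open>N\<^sub>j = 1, N\<^bsub>j+1\<^esub> = 0\<close> and for \<open>M\<^sub>j = 1, M\<^bsub>j-1\<^esub> = 0\<close>. The indices 0 and
  \<open>r + 1\<close> give the terms with \<open>R\<close> on the left-hand side.\<close>

subsection \<open>Occurrences in concatenations\<close>

lemma order_isomorphic_map_strict:
  assumes "\<And>x y. x \<in> set xs \<Longrightarrow> y \<in> set xs \<Longrightarrow> f x < f y \<longleftrightarrow> x < y"
  shows "order_isomorphic (map f xs) ys \<longleftrightarrow> order_isomorphic xs ys"
    "order_isomorphic ys (map f xs) \<longleftrightarrow> order_isomorphic ys xs"
  using assms by (auto simp: order_isomorphic_def)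

lemma order_isomorphic_take:
  "order_isomorphic xs ys \<Longrightarrow> order_isomorphic (take k xs) (take k ys)"
  by (auto simp: order_isomorphic_def)

lemma order_isomorphic_drop:
  "order_isomorphic xs ys \<Longrightarrow> order_isomorphic (drop k xs) (drop k ys)"
  by (auto simp: order_isomorphic_def)

text \<open>Only the relative order of the letters of a pattern matters. This later lets a layered
  pattern be shifted upwards until it becomes part of a larger one.\<close>

lemma occurrences_map_pattern:
  assumes "\<And>x y. x < y \<longleftrightarrow> f x < f y"
  shows "occurrences (map f \<tau>) \<alpha> = occurrences \<tau> \<alpha>"
  unfolding occurrences_def using assms by (simp add: order_isomorphic_map_strict(2))

lemma occurrences_map_word:
  assumes "\<And>x y. x < y \<longleftrightarrow> f x < f y"
  shows "occurrences \<tau> (map f \<alpha>) = occurrences \<tau> \<alpha>"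
proof -
  have "map ((!) (map f \<alpha>)) js = map f (map ((!) \<alpha>) js)" if "set js \<subseteq> {..<length \<alpha>}" for js
    using that by auto
  then show ?thesis
    unfolding occurrences_def using assms by (auto simp: order_isomorphic_map_strict(1) simp del: map_map)
qed

lemma occurrences_Nil: "occurrences [] \<alpha> = {[]}"
  by (auto simp: occurrences_def order_isomorphic_def)

lemma occurrences_word_Nil: "\<tau> \<noteq> [] \<Longrightarrow> occurrences \<tau> [] = {}"
  by (auto simp: occurrences_def order_isomorphic_def)

lemma length_occurrence: "js \<in> occurrences \<tau> \<alpha> \<Longrightarrow> length js = length \<tau>"
  by (auto simp: occurrences_def order_isomorphic_def)

lemma finite_occurrences: "finite (occurrences \<tau> \<alpha>)"
proof (rule finite_subset)
  show "occurrences \<tau> \<alpha> \<subseteq> {js. set js \<subseteq> {..<length \<alpha>} \<and> length js = length \<tau>}"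
    by (auto simp: occurrences_def order_isomorphic_def)
qed (simp add: finite_lists_length_eq)

lemma take_occurrence:
  assumes "js \<in> occurrences \<tau> \<alpha>"
  shows "take k js \<in> occurrences (take k \<tau>) \<alpha>"
  using assms set_take_subset[of k js] order_isomorphic_take[of "map ((!) \<alpha>) js" \<tau> k]
  by (auto simp: occurrences_def take_map intro: sorted_wrt_take)

lemma drop_occurrence:
  assumes "js \<in> occurrences \<tau> \<alpha>"
  shows "drop k js \<in> occurrences (drop k \<tau>) \<alpha>"
  using assms set_drop_subset[of k js] order_isomorphic_drop[of "map ((!) \<alpha>) js" \<tau> k]
  by (auto simp: occurrences_def drop_map intro: sorted_wrt_drop)

text \<open>Cutting an occurrence of \<open>\<sigma> @ \<tau>\<close> after its first
  \<open>length \<sigma>\<close> indices leaves an occurrence of each factor.\<close>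

lemma occurrences_append_eq_empty:
  assumes "occurrences \<sigma> \<alpha> = {} \<or> occurrences \<tau> \<alpha> = {}"
  shows "occurrences (\<sigma> @ \<tau>) \<alpha> = {}"
  using assms take_occurrence[of _ "\<sigma> @ \<tau>" \<alpha> "length \<sigma>"]
    drop_occurrence[of _ "\<sigma> @ \<tau>" \<alpha> "length \<sigma>"] by auto

text \<open>The cuts that exhibit \<open>\<tau>\<close> as a skew sum, the trivial cuts 0 and
  \<open>length \<tau>\<close> included. When a word is itself a skew sum, its two parts can divide
  an occurrence of \<open>\<tau>\<close> only at such a cut.\<close>

definition split_points :: "nat list \<Rightarrow> nat set" where
  "split_points \<tau> = {k. k \<le> length \<tau> \<and> (\<forall>a \<in> set (take k \<tau>). \<forall>b \<in> set (drop k \<tau>). b < a)}"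

text \<open>All comparisons across the boundary of \<open>xs\<close> and \<open>ys\<close> are
  forced, so \<open>\<tau>\<close> must have the same forced comparisons at the same place; what
  remains are the comparisons inside each part.\<close>

lemma order_isomorphic_append_gt:
  assumes gt: "\<And>x y. x \<in> set xs \<Longrightarrow> y \<in> set ys \<Longrightarrow> y < x"
  shows "order_isomorphic (xs @ ys) \<tau> \<longleftrightarrow> length xs \<in> split_points \<tau> \<and>
    order_isomorphic xs (take (length xs) \<tau>) \<and> order_isomorphic ys (drop (length xs) \<tau>)"
    (is "?L \<longleftrightarrow> ?R")
proof
  assume L: ?L
  then have len: "length \<tau> = length xs + length ys" by (simp add: order_isomorphic_def)
  have "b < a" if "a \<in> set (take (length xs) \<tau>)" "b \<in> set (drop (length xs) \<tau>)" for a b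
  proof -
    from that obtain i j where "i < length xs" "a = \<tau> ! i" "j < length ys" "b = \<tau> ! (length xs + j)"
      using len by (auto simp: in_set_conv_nth)
    moreover have "(xs @ ys) ! (length xs + j) < (xs @ ys) ! i"
      using calculation gt by (simp add: nth_append)
    ultimately show ?thesis
      using L len unfolding order_isomorphic_def by (simp del: nth_append_length_plus)
  qed
  then have "length xs \<in> split_points \<tau>" using len by (simp add: split_points_def)
  with order_isomorphic_take[OF L, of "length xs"] order_isomorphic_drop[OF L, of "length xs"]
  show ?R by simp
next
  assume R: ?R
  define k where "k = length xs"
  have k: "k \<le> length \<tau>" and
    gt': "\<And>a b. a \<in> set (take k \<tau>) \<Longrightarrow> b \<in> set (drop k \<tau>) \<Longrightarrow> b < a"
    using R by (auto simp: split_points_def k_def)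
  have len: "length \<tau> = k + length ys"
    using R k by (auto simp: order_isomorphic_def k_def)
  have 1: "\<tau> ! j < \<tau> ! i" "(xs @ ys) ! j < (xs @ ys) ! i"
    if "i < k" "k \<le> j" "j < k + length ys" for i j
  proof -
    have "take k \<tau> ! i \<in> set (take k \<tau>)" using that k by (intro nth_mem) simp
    moreover have "drop k \<tau> ! (j - k) \<in> set (drop k \<tau>)" using that len by (intro nth_mem) simp
    ultimately show "\<tau> ! j < \<tau> ! i" using gt' that k by fastforce
    show "(xs @ ys) ! j < (xs @ ys) ! i" using that gt by (auto simp: nth_append k_def)
  qed
  show ?L unfolding order_isomorphic_def
  proof (intro conjI allI impI)
    show "length (xs @ ys) = length \<tau>" using len k_def by simp
    fix i j assume "i < length (xs @ ys)" "j < length (xs @ ys)"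
    then have ij: "i < k + length ys" "j < k + length ys" by (simp_all add: k_def)
    consider "i < k" "j < k" | "i < k" "k \<le> j" | "k \<le> i" "j < k" | "k \<le> i" "k \<le> j" by linarith
    then show "((xs @ ys) ! i < (xs @ ys) ! j) = (\<tau> ! i < \<tau> ! j)"
    proof cases
      case 1
      then show ?thesis using R by (simp add: order_isomorphic_def nth_append k_def)
    next
      case 2
      then show ?thesis using 1[of i j] ij by simp
    next
      case 3
      then show ?thesis using 1[of j i] ij by simp
    next
      case 4
      have "order_isomorphic ys (drop k \<tau>)" using R by (simp add: k_def)
      then have "ys ! (i - k) < ys ! (j - k) \<longleftrightarrow> drop k \<tau> ! (i - k) < drop k \<tau> ! (j - k)"
        using 4 ij unfolding order_isomorphic_def by (metis less_diff_conv2 add.commute)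
      then show ?thesis using 4 k by (simp add: nth_append k_def)
    qed
  qed
qed

text \<open>Used with \<open>n = length xs\<close>: the indices below \<open>n\<close> point into
  \<open>xs\<close>, and the others, lowered by \<open>n\<close>, become indices into
  \<open>ys\<close>.\<close>

lemma strict_sorted_split:
  fixes js :: "nat list"
  assumes "sorted_wrt (<) js"
  obtains as bs where "js = as @ map ((+) n) bs" "\<forall>a \<in> set as. a < n"
    "sorted_wrt (<) as" "sorted_wrt (<) bs"
proof
  let ?as = "takeWhile (\<lambda>a. a < n) js" and ?cs = "dropWhile (\<lambda>a. a < n) js"
  let ?bs = "map (\<lambda>c. c - n) ?cs"
  have s: "sorted_wrt (<) (?as @ ?cs)" using assms by simp
  have ge: "n \<le> c" if "c \<in> set ?cs" for c
  proof (cases ?cs)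
    case (Cons c0 cs)
    then have "n \<le> c0" by (metis hd_dropWhile list.distinct(1) list.sel(1) not_less)
    moreover have "c0 \<le> c" using s that Cons unfolding sorted_wrt_append by auto
    ultimately show ?thesis by simp
  next
    case Nil
    then show ?thesis using that by (simp only: list.set empty_iff)
  qed
  have "map ((+) n) ?bs = ?cs" by (simp add: ge map_idI)
  then show "js = ?as @ map ((+) n) ?bs" by simp
  show "\<forall>a \<in> set ?as. a < n" by (auto dest: set_takeWhileD)
  show "sorted_wrt (<) ?as" using s by (simp only: sorted_wrt_append)
  have "sorted_wrt (<) ?cs" using s by (simp only: sorted_wrt_append)
  then show "sorted_wrt (<) ?bs"
    unfolding sorted_wrt_map
    by (rule sorted_wrt_mono_rel[rotated]) (use ge in \<open>auto intro: diff_less_mono\<close>)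
qed

lemma append_occurrence_iff:
  assumes gt: "\<And>x y. x \<in> set xs \<Longrightarrow> y \<in> set ys \<Longrightarrow> y < x"
    and as: "\<forall>a \<in> set as. a < length xs"
  shows "as @ map ((+) (length xs)) bs \<in> occurrences \<tau> (xs @ ys) \<longleftrightarrow>
    length as \<in> split_points \<tau> \<and> as \<in> occurrences (take (length as) \<tau>) xs \<and>
    bs \<in> occurrences (drop (length as) \<tau>) ys"
proof (cases "set bs \<subseteq> {..<length ys}")
  case True
  have "map ((!) (xs @ ys)) (as @ map ((+) (length xs)) bs) = map ((!) xs) as @ map ((!) ys) bs"
    using as by (auto simp: nth_append)
  moreover have "y < x" if "x \<in> set (map ((!) xs) as)" "y \<in> set (map ((!) ys) bs)" for x y
    using that as True by (auto intro!: gt)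
  ultimately have "order_isomorphic (map ((!) (xs @ ys)) (as @ map ((+) (length xs)) bs)) \<tau> \<longleftrightarrow>
      length as \<in> split_points \<tau> \<and> order_isomorphic (map ((!) xs) as) (take (length as) \<tau>)
      \<and> order_isomorphic (map ((!) ys) bs) (drop (length as) \<tau>)"
    by (simp only: order_isomorphic_append_gt length_map)
  then show ?thesis
    using as True unfolding occurrences_def mem_Collect_eq
    by (auto simp: sorted_wrt_append sorted_wrt_map intro: trans_less_add1)
next
  case False
  then show ?thesis by (auto simp: occurrences_def)
qed

text \<open>An occurrence is determined by its part in \<open>xs\<close> and its part in
  \<open>ys\<close>, which are independent once the cut is fixed. The cut is the length of the first
  part, so different cuts give different occurrences.\<close>

lemma card_occurrences_append:
  assumes gt: "\<And>x y. x \<in> set xs \<Longrightarrow> y \<in> set ys \<Longrightarrow> y < x"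
  shows "card (occurrences \<tau> (xs @ ys)) =
    (\<Sum>k \<in> split_points \<tau>. card (occurrences (take k \<tau>) xs) * card (occurrences (drop k \<tau>) ys))"
proof -
  let ?D = "SIGMA k:split_points \<tau>. occurrences (take k \<tau>) xs \<times> occurrences (drop k \<tau>) ys"
  let ?f = "\<lambda>(k :: nat, as, bs). as @ map ((+) (length xs)) bs"
  have len: "length as = k" if "k \<in> split_points \<tau>" "as \<in> occurrences (take k \<tau>) xs" for k as
    using that length_occurrence[of as] by (auto simp: split_points_def)
  have lt: "\<forall>a \<in> set as. a < length xs" if "as \<in> occurrences \<sigma> xs" for as \<sigma>
    using that by (auto simp: occurrences_def)
  have "bij_betw ?f ?D (occurrences \<tau> (xs @ ys))"
  proof (rule bij_betw_imageI)
    show "inj_on ?f ?D"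
    proof (rule inj_onI)
      fix p q assume p: "p \<in> ?D" and q: "q \<in> ?D" and eq: "?f p = ?f q"
      obtain k as bs k' as' bs' where pq: "p = (k, as, bs)" "q = (k', as', bs')"
        by (cases p, cases q) auto
      \<comment> \<open>The first part is recovered from the joined index list as its initial run of
        indices below \<open>length xs\<close>.\<close>
      have tw: "takeWhile (\<lambda>a. a < length xs) (cs @ map ((+) (length xs)) ds) = cs"
        if "\<forall>a \<in> set cs. a < length xs" for cs ds
        using that by (cases ds) (simp_all add: takeWhile_append2 takeWhile_eq_all_conv)
      have "as = as'" using eq p q lt pq tw[of as bs] tw[of as' bs'] by auto
      moreover have "bs = bs'"
        using eq pq \<open>as = as'\<close> by (simp add: inj_map_eq_map[of "(+) (length xs)"])
      ultimately show "p = q" using len[of k as] len[of k' as'] p q pq by auto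
    qed
    show "?f ` ?D = occurrences \<tau> (xs @ ys)"
    proof (intro equalityI subsetI)
      fix js assume "js \<in> ?f ` ?D"
      then obtain k as bs where *: "k \<in> split_points \<tau>" "as \<in> occurrences (take k \<tau>) xs"
        "bs \<in> occurrences (drop k \<tau>) ys" "js = as @ map ((+) (length xs)) bs" by auto
      with len[of k as] show "js \<in> occurrences \<tau> (xs @ ys)"
        using append_occurrence_iff[of xs ys as bs \<tau>, OF gt lt] by blast
    next
      fix js assume js: "js \<in> occurrences \<tau> (xs @ ys)"
      then obtain as bs where *: "js = as @ map ((+) (length xs)) bs" "\<forall>a \<in> set as. a < length xs"
        using strict_sorted_split[of js "length xs"] unfolding occurrences_def by blast
      then have "(length as, as, bs) \<in> ?D"
        using append_occurrence_iff[of xs ys as bs \<tau>, OF gt] js by blast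
      then show "js \<in> ?f ` ?D" using * by force
    qed
  qed
  then have "card (occurrences \<tau> (xs @ ys)) = card ?D" by (simp add: bij_betw_same_card)
  also have "finite (split_points \<tau>)"
    by (rule finite_subset[of _ "{..length \<tau>}"]) (auto simp: split_points_def)
  then have "card ?D = (\<Sum>k \<in> split_points \<tau>.
      card (occurrences (take k \<tau>) xs) * card (occurrences (drop k \<tau>) ys))"
    by (simp add: card_SigmaI finite_occurrences card_cartesian_product)
  finally show ?thesis .
qed

section \<open>Words that end in their greatest letter\<close>

lemma order_isomorphic_snoc_greatest:
  assumes "\<forall>x \<in> set xs. x < y" "length xs = length \<sigma>"
  shows "order_isomorphic (xs @ [y]) (\<sigma> @ [s]) \<longleftrightarrow> order_isomorphic xs \<sigma> \<and> (\<forall>a \<in> set \<sigma>. a < s)"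
    (is "?L \<longleftrightarrow> ?R")
proof
  assume L: ?L
  have "\<sigma> ! i < s" if "i < length \<sigma>" for i
  proof -
    have "(xs @ [y]) ! i < (xs @ [y]) ! length xs" using that assms by (simp add: nth_append)
    then have "(\<sigma> @ [s]) ! i < (\<sigma> @ [s]) ! length \<sigma>"
      using L that assms(2) unfolding order_isomorphic_def
      by (simp del: nth_append_length)
    then show ?thesis using that by (simp add: nth_append)
  qed
  moreover have "order_isomorphic xs \<sigma>"
    using order_isomorphic_take[OF L, of "length xs"] assms(2) by simp
  ultimately show ?R by (auto simp: in_set_conv_nth)
next
  assume ?R
  have "xs ! i < y \<and> \<sigma> ! i < s \<and> \<not> y < xs ! i \<and> \<not> s < \<sigma> ! i"
    if "i < length \<sigma>" for i
  proof -
    have "xs ! i < y" using assms that by simp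
    moreover have "\<sigma> ! i < s" using \<open>?R\<close> that by simp
    ultimately show ?thesis by simp
  qed
  with \<open>?R\<close> show ?L using assms(2)
    unfolding order_isomorphic_def by (auto simp: nth_append less_Suc_eq)
qed

text \<open>Indices increase, so an occurrence that uses the last index ends with it. The greatest
  letter of the word then plays the last letter of the pattern, which must be the greatest letter
  there too.\<close>

lemma occurrences_snoc_word:
  assumes gt: "\<forall>x \<in> set xs. x < y"
  shows "occurrences (\<sigma> @ [s]) (xs @ [y]) = occurrences (\<sigma> @ [s]) xs \<union>
    (if \<forall>a \<in> set \<sigma>. a < s then (\<lambda>js. js @ [length xs]) ` occurrences \<sigma> xs else {})"
proof -
  have nth: "map ((!) (xs @ [y])) js = map ((!) xs) js" if "set js \<subseteq> {..<length xs}" for js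
    using that by (auto simp: nth_append)
  have 1: "js \<in> occurrences \<tau> (xs @ [y]) \<longleftrightarrow> js \<in> occurrences \<tau> xs"
    if "set js \<subseteq> {..<length xs}" for js \<tau>
    unfolding occurrences_def mem_Collect_eq nth[OF that] using that by auto
  have 2: "js @ [length xs] \<in> occurrences (\<sigma> @ [s]) (xs @ [y]) \<longleftrightarrow>
      js \<in> occurrences \<sigma> xs \<and> (\<forall>a \<in> set \<sigma>. a < s)" for js
  proof (cases "set js \<subseteq> {..<length xs} \<and> length js = length \<sigma>")
    case True
    then have "order_isomorphic (map ((!) (xs @ [y])) js @ [y]) (\<sigma> @ [s]) \<longleftrightarrow>
        order_isomorphic (map ((!) xs) js) \<sigma> \<and> (\<forall>a \<in> set \<sigma>. a < s)"
      unfolding nth[OF conjunct1[OF True]] using gt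
      by (intro order_isomorphic_snoc_greatest) auto
    then show ?thesis using True
      by (auto simp: occurrences_def sorted_wrt_append)
  next
    case False
    have "set js \<subseteq> {..<length xs} \<and> length js = length \<sigma>"
      if "js @ [length xs] \<in> occurrences (\<sigma> @ [s]) (xs @ [y])"
      using that by (auto simp: occurrences_def sorted_wrt_append order_isomorphic_def)
    moreover have "set js \<subseteq> {..<length xs} \<and> length js = length \<sigma>" if "js \<in> occurrences \<sigma> xs"
      using that length_occurrence[of js] by (auto simp: occurrences_def)
    ultimately show ?thesis using False by blast
  qed
  have 3: "set js \<subseteq> {..<length xs} \<or> (\<exists>js'. js = js' @ [length xs])"
    if "js \<in> occurrences (\<sigma> @ [s]) (xs @ [y])" for js
  proof (cases js rule: rev_cases)
    case (snoc js' j)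
    have "sorted_wrt (<) js" "set js \<subseteq> {..<Suc (length xs)}"
      using that by (auto simp: occurrences_def)
    then show ?thesis using snoc by (cases "j = length xs") (auto simp: sorted_wrt_append)
  qed simp
  have 4: "set js \<subseteq> {..<length xs}" if "js \<in> occurrences \<tau> xs" for js \<tau>
    using that by (simp add: occurrences_def)
  show ?thesis (is "?L = ?R")
  proof (intro equalityI subsetI)
    fix js assume js: "js \<in> ?L"
    from 3[OF this] show "js \<in> ?R"
    proof
      assume "set js \<subseteq> {..<length xs}"
      then show ?thesis using 1 js by blast
    next
      assume "\<exists>js'. js = js' @ [length xs]"
      then obtain js' where "js = js' @ [length xs]" by blast
      then show ?thesis using 2 js by auto
    qed
  next
    fix js assume "js \<in> ?R"
    then consider "js \<in> occurrences (\<sigma> @ [s]) xs"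
      | js' where "\<forall>a \<in> set \<sigma>. a < s" "js' \<in> occurrences \<sigma> xs" "js = js' @ [length xs]"
      by (auto split: if_splits)
    then show "js \<in> ?L"
      by cases (use 1 2 4 in blast)+
  qed
qed

lemma card_occurrences_snoc_word:
  assumes gt: "\<forall>x \<in> set xs. x < y"
  shows "card (occurrences (\<sigma> @ [s]) (xs @ [y])) = card (occurrences (\<sigma> @ [s]) xs) +
    (if \<forall>a \<in> set \<sigma>. a < s then card (occurrences \<sigma> xs) else 0)"
proof -
  have "occurrences (\<sigma> @ [s]) xs \<inter> (\<lambda>js. js @ [length xs]) ` occurrences \<sigma> xs = {}"
    by (auto simp: occurrences_def)
  moreover have "card ((\<lambda>js. js @ [length xs]) ` occurrences \<sigma> xs) = card (occurrences \<sigma> xs)"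
    by (intro card_image) (auto simp: inj_on_def)
  ultimately show ?thesis
    by (simp add: occurrences_snoc_word[OF gt] card_Un_disjoint finite_occurrences)
qed


subsection \<open>Decomposition of 132-avoiding permutations\<close>

definition av132 :: "nat \<Rightarrow> nat list set" where
  "av132 n = {\<alpha> \<in> permutations_of_set {1..n}. avoids [1,3,2] \<alpha>}"

text \<open>Both arguments are meant to be permutations of initial segments. The bracketing groups
  the largest letter with the shifted \<open>\<beta>\<close>, so that the outer concatenation is a
  skew sum.\<close>

definition join132 :: "nat list \<Rightarrow> nat list \<Rightarrow> nat list" where
  "join132 \<beta> \<gamma> = (map ((+) (length \<gamma>)) \<beta> @ [Suc (length \<beta> + length \<gamma>)]) @ \<gamma>"

lemma finite_av132: "finite (av132 n)"
  by (simp add: av132_def)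

lemma av132D:
  assumes "\<alpha> \<in> av132 n"
  shows "set \<alpha> = {1..n}" "distinct \<alpha>" "length \<alpha> = n" "avoids [1,3,2] \<alpha>"
  using assms distinct_card[of \<alpha>] by (auto simp: av132_def permutations_of_set_def)

lemma av132_0: "av132 0 = {[]}"
  by (auto simp: av132_def avoids_def occurrences_word_Nil permutations_of_set_def)

text \<open>The pattern is first cut between the two sides of the skew sum. The prefix of length
  \<open>k\<close> then either lies in \<open>\<beta>\<close> or uses the largest letter as its own
  last and greatest letter, the one at position \<open>k - 1\<close>; the guard
  \<open>k \<noteq> 0\<close> excludes the empty prefix.\<close>

lemma card_occurrences_join132:
  assumes "set \<beta> = {1..length \<beta>}" "set \<gamma> = {1..length \<gamma>}"
  shows "card (occurrences \<tau> (join132 \<beta> \<gamma>)) = (\<Sum>k \<in> split_points \<tau>.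
    (card (occurrences (take k \<tau>) \<beta>) +
      (if k \<noteq> 0 \<and> (\<forall>a \<in> set (take (k - 1) \<tau>). a < \<tau> ! (k - 1))
       then card (occurrences (take (k - 1) \<tau>) \<beta>) else 0))
    * card (occurrences (drop k \<tau>) \<gamma>))"
proof -
  let ?xs = "map ((+) (length \<gamma>)) \<beta>" and ?y = "Suc (length \<beta> + length \<gamma>)"
  have 1: "y < x" if "x \<in> set (?xs @ [?y])" "y \<in> set \<gamma>" for x y
    using that assms by auto
  have 2: "\<forall>x \<in> set ?xs. x < ?y" using assms by auto
  have shift: "occurrences \<sigma> ?xs = occurrences \<sigma> \<beta>" for \<sigma>
    by (rule occurrences_map_word) simp
  have "card (occurrences (take k \<tau>) (?xs @ [?y])) = card (occurrences (take k \<tau>) \<beta>) +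
      (if k \<noteq> 0 \<and> (\<forall>a \<in> set (take (k - 1) \<tau>). a < \<tau> ! (k - 1))
       then card (occurrences (take (k - 1) \<tau>) \<beta>) else 0)" if "k \<in> split_points \<tau>" for k
  proof (cases k)
    case (Suc k')
    then have "take k \<tau> = take k' \<tau> @ [\<tau> ! k']"
      using that by (simp add: split_points_def take_Suc_conv_app_nth)
    then show ?thesis
      using Suc by (simp add: card_occurrences_snoc_word[OF 2] shift del: take_Suc)
  qed (simp add: occurrences_Nil)
  moreover have "card (occurrences \<tau> (join132 \<beta> \<gamma>)) = (\<Sum>k \<in> split_points \<tau>.
      card (occurrences (take k \<tau>) (?xs @ [?y])) * card (occurrences (drop k \<tau>) \<gamma>))"
    unfolding join132_def by (rule card_occurrences_append) (rule 1)
  ultimately show ?thesis by (simp only: cong: sum.cong)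
qed

lemma split_points_132: "split_points [1,3,2] = {0,3}"
proof -
  have "k \<in> split_points [1,3,2] \<longleftrightarrow> k = 0 \<or> k = 3" for k
  proof -
    consider "k = 0" | "k = 1" | "k = 2" | "k = 3" | "k > 3" by linarith
    then show ?thesis by cases (simp_all add: split_points_def eval_nat_numeral)
  qed
  then show ?thesis by auto
qed

lemma avoids_iff_card: "avoids \<tau> \<alpha> \<longleftrightarrow> card (occurrences \<tau> \<alpha>) = 0"
  by (simp add: avoids_def finite_occurrences)

text \<open>The pattern 132 has only trivial cuts, so an occurrence lies wholly on one side. The
  largest letter cannot end it, because 2 is not the greatest letter of the pattern.\<close>

lemma avoids_join132_iff:
  assumes "set \<beta> = {1..length \<beta>}" "set \<gamma> = {1..length \<gamma>}"
  shows "avoids [1,3,2] (join132 \<beta> \<gamma>) \<longleftrightarrow> avoids [1,3,2] \<beta> \<and> avoids [1,3,2] \<gamma>"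
  unfolding avoids_iff_card card_occurrences_join132[OF assms] split_points_132
  by (auto simp: occurrences_Nil)

lemma join132_in_av132:
  assumes "\<beta> \<in> av132 k" "\<gamma> \<in> av132 l"
  shows "join132 \<beta> \<gamma> \<in> av132 (Suc (k + l))"
proof -
  note b = av132D[OF assms(1)] and c = av132D[OF assms(2)]
  have "avoids [1,3,2] (join132 \<beta> \<gamma>)" 
    using b c avoids_join132_iff[of \<beta> \<gamma>] by (simp del: One_nat_def)
  moreover have "(\<lambda>i. l + i) ` {1..k} = {Suc l..l + k}" by simp
  then have "set (join132 \<beta> \<gamma>) = {1..Suc (k + l)}"
    using b c by (auto simp: join132_def)
  moreover have "distinct (join132 \<beta> \<gamma>)" using b c by (auto simp: join132_def distinct_map)
  ultimately show ?thesis by (simp add: av132_def permutations_of_set_def)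
qed

lemma join132_inject:
  assumes "length \<beta> + length \<gamma> = length \<beta>' + length \<gamma>'" "length \<beta> = length \<beta>'"
    "join132 \<beta> \<gamma> = join132 \<beta>' \<gamma>'"
  shows "\<beta> = \<beta>' \<and> \<gamma> = \<gamma>'"
  using assms by (auto simp: join132_def inj_map_eq_map)

text \<open>A number up to \<open>Max B\<close> that lay in \<open>A\<close> would have to exceed
  \<open>Max B\<close>; hence \<open>B\<close> has no gaps.\<close>

lemma lower_part_eq_atLeastAtMost:
  fixes A B :: "nat set"
  assumes "A \<union> B = {1..n}" "\<And>a b. a \<in> A \<Longrightarrow> b \<in> B \<Longrightarrow> b < a"
  shows "B = {1..card B}"
proof (cases "B = {}")
  case False
  have fin: "finite B" using assms(1) by (metis finite_Un finite_atLeastAtMost)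
  have "B = {1..Max B}"
  proof (intro equalityI subsetI)
    fix b assume "b \<in> B"
    then show "b \<in> {1..Max B}" using assms(1) fin by auto
  next
    fix b assume "b \<in> {1..Max B}"
    moreover have "Max B \<in> B" using fin False by simp
    ultimately show "b \<in> B" using assms by (metis UnE UnI2 atLeastAtMost_iff le_trans not_less)
  qed
  then show ?thesis by (metis card_atLeastAtMost add_diff_cancel_right' Suc_eq_plus1)
qed simp

text \<open>A letter before the maximum that is smaller than some letter after it would form 132
  together with the maximum. So the letters before the maximum are the large ones, and both value
  sets are intervals.\<close>

lemma av132_SucE:
  assumes "\<alpha> \<in> av132 (Suc n)"
  obtains k \<beta> \<gamma> where "k \<le> n" "\<beta> \<in> av132 k" "\<gamma> \<in> av132 (n - k)" "\<alpha> = join132 \<beta> \<gamma>"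
proof -
  note a = av132D[OF assms]
  have "Suc n \<in> set \<alpha>" using a(1) by simp
  then obtain xs ys where \<alpha>: "\<alpha> = xs @ [Suc n] @ ys" by (metis append_Cons append_Nil split_list)
  let ?k = "length xs" and ?l = "length ys"
  have kl: "?k + ?l = n" using a(3) \<alpha> by simp
  have un: "set xs \<union> set ys = {1..n}"
  proof -
    have "set xs \<union> set ys = set \<alpha> - {Suc n}" using a(2) \<alpha> by auto
    then show ?thesis using a(1) by auto
  qed
  have dist: "distinct xs" "distinct ys" "set xs \<inter> set ys = {}" using a(2) \<alpha> by auto
  have gt: "y < x" if "x \<in> set xs" "y \<in> set ys" for x y
  proof (rule ccontr)
    assume "\<not> y < x"
    then have "x < y" using that dist(3) by (metis disjoint_iff nat_neq_iff)
    from that obtain i j where ij: "i < ?k" "x = xs ! i" "j < ?l" "y = ys ! j"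
      by (auto simp: in_set_conv_nth)
    have "y \<in> {1..n}" using un that(2) by blast
    then have yn: "y < Suc n" by simp
    have "\<alpha> ! i = x" "\<alpha> ! ?k = Suc n" "\<alpha> ! (Suc (?k + j)) = y"
      using ij by (simp_all add: \<alpha> nth_append)
    moreover have "order_isomorphic [x, Suc n, y] [1,3,2]"
      using \<open>x < y\<close> yn by (auto simp: order_isomorphic_def less_Suc_eq nth_Cons split: nat.splits)
    ultimately have "[i, ?k, Suc (?k + j)] \<in> occurrences [1,3,2] \<alpha>"
      using ij a(3) kl by (simp add: occurrences_def)
    then show False using a(4) by (simp add: avoids_def)
  qed
  have ys: "set ys = {1..?l}"
    using lower_part_eq_atLeastAtMost[of "set xs" "set ys" n, OF un gt] dist(2)
    by (simp add: distinct_card)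
  have xs: "set xs = {Suc ?l..n}"
  proof -
    have "set xs = {1..n} - {1..?l}" using un ys dist(3) by blast
    also have "{1..n} - {1..?l} = {Suc ?l..n}" by auto
    finally show ?thesis .
  qed
  let ?\<beta> = "map (\<lambda>x. x - ?l) xs"
  have "map ((+) ?l) ?\<beta> = xs" using xs by (auto intro: map_idI)
  then have j: "\<alpha> = join132 ?\<beta> ys" using kl by (simp add: join132_def \<alpha> add.commute)
  have inj: "inj_on (\<lambda>x. x - ?l) {Suc ?l..n}" by (auto simp: inj_on_def)
  have "{Suc ?l..n} = (+) ?l ` {1..?k}" using kl by (simp add: add.commute)
  then have \<beta>': "set ?\<beta> = {1..?k}" unfolding set_map xs by (simp only: image_image) simp
  then have \<beta>: "set ?\<beta> = {1..length ?\<beta>}" by (simp only: length_map)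
  have "distinct ?\<beta>" unfolding distinct_map xs using dist(1) inj by blast
  moreover have "avoids [1,3,2] ?\<beta>" "avoids [1,3,2] ys"
    using a(4) unfolding j avoids_join132_iff[OF \<beta> ys] by blast+
  ultimately have "?\<beta> \<in> av132 ?k" "ys \<in> av132 ?l"
    using \<beta>' ys dist(2) unfolding av132_def permutations_of_set_def by blast+
  moreover have "?k \<le> n" "?l = n - ?k" using kl by simp_all
  ultimately show ?thesis using that j by metis
qed

lemma bij_betw_join132:
  "bij_betw (\<lambda>(k, \<beta>, \<gamma>). join132 \<beta> \<gamma>) (SIGMA k:{..n}. av132 k \<times> av132 (n - k)) (av132 (Suc n))"
    (is "bij_betw ?f ?D _")
proof (rule bij_betw_imageI)
  show "inj_on ?f ?D"
  proof (rule inj_onI)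
    fix p q assume p: "p \<in> ?D" and q: "q \<in> ?D" and eq: "?f p = ?f q"
    obtain k \<beta> \<gamma> k' \<beta>' \<gamma>' where pq: "p = (k, \<beta>, \<gamma>)" "q = (k', \<beta>', \<gamma>')" by (cases p, cases q) auto
    have l: "length \<beta> = k" "length \<gamma> = n - k" "k \<le> n" "length \<beta>' = k'" "length \<gamma>' = n - k'" "k' \<le> n"
      using p q pq av132D(3) by auto
    have \<beta>: "set \<beta> = {1..k}" "set \<beta>' = {1..k'}" and \<gamma>: "set \<gamma> = {1..n - k}" "set \<gamma>' = {1..n - k'}"
      using p q pq av132D(1) by auto
    \<comment> \<open>The first factor is read off as the letters in front of the maximum
      \<open>Suc n\<close>; its length then gives \<open>k\<close>.\<close>
    have tw: "takeWhile (\<lambda>a. a \<le> n) (join132 \<delta> \<epsilon>) = map ((+) (length \<epsilon>)) \<delta>"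
      if "length \<delta> + length \<epsilon> = n" "set \<delta> = {1..length \<delta>}" for \<delta> \<epsilon> :: "nat list"
      using that by (auto simp: join132_def takeWhile_append)
    have "map ((+) (length \<gamma>)) \<beta> = map ((+) (length \<gamma>')) \<beta>'"
      using tw[of \<beta> \<gamma>] tw[of \<beta>' \<gamma>'] eq pq l \<beta> by simp
    then have "length \<beta> = length \<beta>'" by (metis length_map)
    then show "p = q" using join132_inject[of \<beta> \<gamma> \<beta>' \<gamma>'] eq pq l by auto
  qed
  show "?f ` ?D = av132 (Suc n)"
  proof (intro equalityI subsetI)
    fix \<alpha> assume "\<alpha> \<in> ?f ` ?D"
    then obtain k \<beta> \<gamma> where "k \<le> n" "\<beta> \<in> av132 k" "\<gamma> \<in> av132 (n - k)" "\<alpha> = join132 \<beta> \<gamma>" by auto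
    then show "\<alpha> \<in> av132 (Suc n)" using join132_in_av132[of \<beta> k \<gamma> "n - k"] by simp
  next
    fix \<alpha> assume "\<alpha> \<in> av132 (Suc n)"
    then show "\<alpha> \<in> ?f ` ?D" by (elim av132_SucE) force
  qed
qed

section \<open>Weighted generating functions of 132-avoiding permutations\<close>

definition weight_fps :: "(nat list \<Rightarrow> real) \<Rightarrow> real fps" where
  "weight_fps f = Abs_fps (\<lambda>n. \<Sum>\<alpha> \<in> av132 n. f \<alpha>)"

text \<open>Summing a product weight over all pairs of factors gives a Cauchy product. The factor
  \<open>fps_X\<close> accounts for the largest letter, the constant term for the empty
  permutation.\<close>

lemma weight_fps_join132:
  assumes "\<And>k l \<beta> \<gamma>. \<beta> \<in> av132 k \<Longrightarrow> \<gamma> \<in> av132 l \<Longrightarrow>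
    f (join132 \<beta> \<gamma>) = (\<Sum>i \<in> I. u i \<beta> * v i \<gamma>)"
  shows "weight_fps f = fps_const (f []) + fps_X * (\<Sum>i \<in> I. weight_fps (u i) * weight_fps (v i))"
proof (rule fps_ext)
  fix n
  show "weight_fps f $ n =
    (fps_const (f []) + fps_X * (\<Sum>i \<in> I. weight_fps (u i) * weight_fps (v i))) $ n"
  proof (cases n)
    case 0
    then show ?thesis by (simp add: weight_fps_def av132_0)
  next
    case (Suc n')
    have "(\<Sum>\<alpha> \<in> av132 (Suc n'). f \<alpha>) =
        (\<Sum>(k, \<beta>, \<gamma>) \<in> (SIGMA k:{..n'}. av132 k \<times> av132 (n' - k)). f (join132 \<beta> \<gamma>))"
      using sum.reindex_bij_betw[OF bij_betw_join132[of n'], of f] by (simp add: case_prod_unfold)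
    also have "\<dots> = (\<Sum>k\<le>n'. \<Sum>(\<beta>, \<gamma>) \<in> av132 k \<times> av132 (n' - k). f (join132 \<beta> \<gamma>))"
      by (subst sum.Sigma) (auto simp: finite_av132 case_prod_unfold)
    also have "\<dots> = (\<Sum>k\<le>n'. \<Sum>(\<beta>, \<gamma>) \<in> av132 k \<times> av132 (n' - k). \<Sum>i \<in> I. u i \<beta> * v i \<gamma>)"
      using assms by (intro sum.cong refl) auto
    also have "\<dots> = (\<Sum>k\<le>n'. \<Sum>i \<in> I. (\<Sum>\<beta> \<in> av132 k. u i \<beta>) * (\<Sum>\<gamma> \<in> av132 (n' - k). v i \<gamma>))"
      by (intro sum.cong refl, simp only: case_prod_unfold, subst sum.swap)
        (simp add: sum_product sum.cartesian_product case_prod_unfold)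
    also have "\<dots> = (\<Sum>i \<in> I. \<Sum>k\<le>n'. (\<Sum>\<beta> \<in> av132 k. u i \<beta>) * (\<Sum>\<gamma> \<in> av132 (n' - k). v i \<gamma>))"
      by (rule sum.swap)
    finally show ?thesis
      unfolding Suc
      by (simp add: weight_fps_def fps_sum_nth fps_mult_nth[of "Abs_fps _"] atLeast0AtMost)
  qed
qed


subsection \<open>Layered patterns\<close>

text \<open>With \<open>m\<^bsub>r+1\<^esub> = 0\<close>, \<open>blocks m j (r + 1)\<close> is the pattern \<open>[m\<^sub>j, \<dots>, m\<^sub>r]\<close>, and \<open>blocks m 0 j\<close> is
  \<open>[d\<^bsub>0j\<^esub>, \<dots>, d\<^bsub>j-1,j\<^esub>]\<close> shifted up by \<open>m\<^sub>j\<close>, which does not affect occurrences.\<close>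

definition blocks :: "(nat \<Rightarrow> nat) \<Rightarrow> nat \<Rightarrow> nat \<Rightarrow> nat list" where
  "blocks m a c = concat (map (\<lambda>i. [Suc (m (Suc i))..<Suc (m i)]) [a..<c])"

lemma blocks_same: "blocks m a a = []"
  by (simp add: blocks_def)

lemma blocks_append:
  assumes "a \<le> j" "j \<le> c"
  shows "blocks m a c = blocks m a j @ blocks m j c"
proof -
  obtain k where "c = j + k" using assms(2) le_iff_add by blast
  then have "[a..<c] = [a..<j] @ [j..<c]"
    using upt_add_eq_append[OF assms(1), of k] by (simp only:)
  then show ?thesis by (simp add: blocks_def)
qed

lemma blocks_Suc: "blocks m a (Suc a) = [Suc (m (Suc a))..<Suc (m a)]"
  by (simp add: blocks_def)

text \<open>The condition \<open>m c = 0\<close> supplies the final bound that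
  \<open>layered\<close> leaves implicit.\<close>

lemma layered_eq_blocks:
  assumes "a < c" "m c = 0"
  shows "layered (map m [a..<c]) = blocks m a c"
proof -
  have "layered (map m [a..<Suc b]) = blocks m a (Suc b)" if "a \<le> b" "m (Suc b) = 0" for b
    using that
  proof (induction a rule: inc_induct)
    case base
    then show ?case by (simp add: blocks_def)
  next
    case (step n)
    have "[n..<Suc b] = n # [Suc n..<Suc b]" "[Suc n..<Suc b] = Suc n # [Suc (Suc n)..<Suc b]"
      using step by (simp_all add: upt_conv_Cons)
    then have "layered (map m [n..<Suc b]) = [Suc (m (Suc n))..<Suc (m n)] @ layered (map m [Suc n..<Suc b])"
      by simp
    also have "\<dots> = blocks m n (Suc b)"
      using step blocks_append[of n "Suc n" "Suc b" m] by (simp add: blocks_Suc)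
    finally show ?case .
  qed
  from this[of "c - 1"] show ?thesis using assms by (cases c) auto
qed

text \<open>Lowering all bounds by \<open>k\<close> lowers all letters by \<open>k\<close>; the
  assumption keeps the subtraction from truncating. With \<open>k = m j\<close> this relates the
  patterns in the differences to prefixes of a single pattern.\<close>

lemma map_add_blocks_diff:
  assumes "\<And>i. a \<le> i \<Longrightarrow> i \<le> c \<Longrightarrow> k \<le> m i"
  shows "map ((+) k) (blocks (\<lambda>i. m i - k) a c) = blocks m a c"
proof -
  have "map ((+) k) [Suc (m (Suc i) - k)..<Suc (m i - k)] = [Suc (m (Suc i))..<Suc (m i)]"
    if "i \<in> set [a..<c]" for i
    using assms[of i] assms[of "Suc i"] that by (intro nth_equalityI) (auto simp del: upt_Suc)
  then show ?thesis
    unfolding blocks_def map_concat map_map by (intro arg_cong[of _ _ concat] map_cong refl) (simp del: upt_Suc)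
qed

text \<open>A cut strictly inside the increasing block \<open>B\<close> would separate two ascending
  neighbours. From the end of \<open>B\<close> on, the cuts are those of
  \<open>\<tau>\<close>.\<close>

lemma split_points_append:
  assumes "sorted_wrt (<) B" "\<And>x y. x \<in> set B \<Longrightarrow> y \<in> set \<tau> \<Longrightarrow> y < x"
  shows "split_points (B @ \<tau>) = insert 0 ((+) (length B) ` split_points \<tau>)"
proof (intro equalityI subsetI)
  fix k assume k: "k \<in> split_points (B @ \<tau>)"
  show "k \<in> insert 0 ((+) (length B) ` split_points \<tau>)"
  proof (cases "k = 0 \<or> length B \<le> k")
    case True
    have "k - length B \<in> split_points \<tau>" if "length B \<le> k"
      using k that by (auto simp: split_points_def)
    then show ?thesis using True by (metis image_eqI insert_iff le_add_diff_inverse)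
  next
    case False
    then have "B ! (k - 1) \<in> set (take k (B @ \<tau>))"
      by (auto simp: in_set_conv_nth intro!: exI[of _ "k - 1"])
    moreover have "B ! k \<in> set (drop k (B @ \<tau>))"
      using False by (auto simp: in_set_conv_nth nth_append intro!: exI[of _ 0])
    ultimately have "B ! k < B ! (k - 1)" using k by (auto simp: split_points_def)
    moreover have "B ! (k - 1) < B ! k" using assms(1) False by (auto intro: sorted_wrt_nth_less)
    ultimately show ?thesis by simp
  qed
next
  fix k assume "k \<in> insert 0 ((+) (length B) ` split_points \<tau>)"
  moreover have "length B + l \<in> split_points (B @ \<tau>)" if "l \<in> split_points \<tau>" for l
    using that assms(2) by (auto simp: split_points_def dest: in_set_dropD)
  ultimately show "k \<in> split_points (B @ \<tau>)" by (auto simp: split_points_def)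
qed

context
  fixes m :: "nat \<Rightarrow> nat" and c :: nat
  assumes decr: "\<And>i. i < c \<Longrightarrow> m (Suc i) < m i"
begin

lemma decr_le: "a \<le> b \<Longrightarrow> b \<le> c \<Longrightarrow> m b \<le> m a"
proof (induction b rule: dec_induct)
  case (step n)
  then show ?case using decr[of n] by simp
qed simp

lemma decr_less: "a < b \<Longrightarrow> b \<le> c \<Longrightarrow> m b < m a"
  using decr[of a] decr_le[of "Suc a" b] by simp

lemma set_blocks: "a \<le> j \<Longrightarrow> j \<le> c \<Longrightarrow> set (blocks m a j) = {Suc (m j)..m a}"
proof (induction a rule: inc_induct)
  case base
  then show ?case by (simp add: blocks_same)
next
  case (step n)
  then have "blocks m n j = [Suc (m (Suc n))..<Suc (m n)] @ blocks m (Suc n) j"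
    using blocks_append[of n "Suc n" j m] by (simp add: blocks_Suc)
  then show ?case using step decr_le[of "Suc n" j] decr_le[of n "Suc n"]
    by (auto simp del: upt_Suc)
qed

lemma length_blocks: "a \<le> j \<Longrightarrow> j \<le> c \<Longrightarrow> length (blocks m a j) = m a - m j"
proof (induction a rule: inc_induct)
  case base
  then show ?case by (simp add: blocks_same)
next
  case (step n)
  then have "blocks m n j = [Suc (m (Suc n))..<Suc (m n)] @ blocks m (Suc n) j"
    using blocks_append[of n "Suc n" j m] by (simp add: blocks_Suc)
  then show ?case using step decr_le[of "Suc n" j] decr_le[of n "Suc n"]
    by (simp del: upt_Suc)
qed

text \<open>The cuts are the boundaries between layers, and \<open>m a - m j\<close> is the total
  length of the layers before the boundary \<open>j\<close>.\<close>

lemma split_points_blocks: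
  "a \<le> c \<Longrightarrow> split_points (blocks m a c) = (\<lambda>j. m a - m j) ` {a..c}"
proof (induction a rule: inc_induct)
  case base
  then show ?case by (auto simp: blocks_same split_points_def)
next
  case (step n)
  have "blocks m n c = [Suc (m (Suc n))..<Suc (m n)] @ blocks m (Suc n) c"
    using blocks_append[of n "Suc n" c m] step by (simp add: blocks_Suc)
  then have "split_points (blocks m n c) = insert 0 ((+) (m n - m (Suc n)) ` split_points (blocks m (Suc n) c))"
    using split_points_append[of "[Suc (m (Suc n))..<Suc (m n)]" "blocks m (Suc n) c"]
      set_blocks[of "Suc n" c] step by (simp del: upt_Suc add: sorted_wrt_upt)
  also have "(+) (m n - m (Suc n)) ` split_points (blocks m (Suc n) c) = (\<lambda>j. m n - m j) ` {Suc n..c}"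
    unfolding step.IH image_image using decr_le[of n "Suc n"] decr_le[of "Suc n"] step.hyps
    by (intro image_cong) auto
  also have "insert 0 ((\<lambda>j. m n - m j) ` {Suc n..c}) = (\<lambda>j. m n - m j) ` {n..c}"
    using step.hyps by (auto simp: atLeastAtMost_insertL[symmetric] simp del: atLeastAtMost_insertL)
  finally show ?case .
qed

text \<open>The cut runs over the layer boundaries. A prefix of whole layers ends in its greatest
  letter only when it is the first layer alone; the extra term for \<open>j = 1\<close> counts that
  layer without its last letter, for which the largest letter of the word stands in.\<close>

lemma card_occurrences_blocks_join132:
  assumes "set \<beta> = {1..length \<beta>}" "set \<gamma> = {1..length \<gamma>}"
  shows "card (occurrences (blocks m 0 c) (join132 \<beta> \<gamma>)) =
    (\<Sum>j\<le>c. (card (occurrences (blocks m 0 j) \<beta>) +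
        (if j = 1 then card (occurrences [Suc (m 1)..<m 0] \<beta>) else 0))
      * card (occurrences (blocks m j c) \<gamma>))"
proof -
  let ?\<tau> = "blocks m 0 c"
  have inj: "inj_on (\<lambda>j. m 0 - m j) {..c}"
  proof (rule linorder_inj_onI')
    fix i j assume "i \<in> {..c}" "j \<in> {..c}" "i < j"
    then show "m 0 - m i \<noteq> m 0 - m j" using decr_less[of i j] decr_le[of 0 i] by simp
  qed
  have take: "take (m 0 - m j) ?\<tau> = blocks m 0 j" "drop (m 0 - m j) ?\<tau> = blocks m j c" if "j \<le> c" for j
    using blocks_append[of 0 j c m] length_blocks[of 0 j] that by simp_all
  have greatest: "(m 0 - m j \<noteq> 0 \<and> (\<forall>a \<in> set (take (m 0 - m j - 1) ?\<tau>). a < ?\<tau> ! (m 0 - m j - 1))) \<longleftrightarrow> j = 1"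
    "j = 1 \<Longrightarrow> take (m 0 - m j - 1) ?\<tau> = [Suc (m 1)..<m 0]" if "j \<le> c" for j
  proof -
    have first: "?\<tau> = [Suc (m 1)..<Suc (m 0)] @ blocks m 1 c" if "1 \<le> c"
      using blocks_append[of 0 1 c m] blocks_Suc[of m 0] that by simp
    show 1: "take (m 0 - m j - 1) ?\<tau> = [Suc (m 1)..<m 0]" if "j = 1"
      using that \<open>j \<le> c\<close> first decr_less[of 0 1] by (simp add: take_upt del: upt_Suc)
    have last: "?\<tau> ! (m 0 - m 1 - 1) = m 0" if "1 \<le> c"
    proof -
      have "m 0 - m 1 - 1 < length [Suc (m 1)..<Suc (m 0)]" using decr_less[of 0 1] that by simp
      then show ?thesis
        using decr_less[of 0 1] that unfolding first[OF that] nth_append by (simp del: upt_Suc)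
    qed
    consider "j = 0" | "j = 1" | "j > 1" by linarith
    then show "(m 0 - m j \<noteq> 0 \<and> (\<forall>a \<in> set (take (m 0 - m j - 1) ?\<tau>). a < ?\<tau> ! (m 0 - m j - 1))) \<longleftrightarrow> j = 1"
    proof cases
      case 2
      then have "?\<tau> ! (m 0 - m j - 1) = m 0"
        using \<open>j \<le> c\<close> last by simp
      then show ?thesis using 1 2 \<open>j \<le> c\<close> decr_less[of 0 1] by simp
    next
      case 3
      have less: "m 1 < m 0" "m j < m 1" using 3 \<open>j \<le> c\<close> decr_less[of 0 1] decr_less[of 1 j] by simp_all
      have len: "length ?\<tau> = m 0 - m c" using length_blocks[of 0 c] by simp
      have le: "m c \<le> m j" using \<open>j \<le> c\<close> decr_le by simp
      \<comment> \<open>The greatest letter ends the first layer, hence comes before the last letter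
        of any prefix with at least two layers.\<close>
      have "?\<tau> ! (m 0 - m 1 - 1) = m 0"
        using 3 \<open>j \<le> c\<close> last by simp
      moreover have "?\<tau> ! (m 0 - m 1 - 1) \<in> set (take (m 0 - m j - 1) ?\<tau>)"
        using less len le by (auto simp: in_set_conv_nth intro!: exI[of _ "m 0 - m 1 - 1"])
      moreover have "?\<tau> ! (m 0 - m j - 1) \<in> set ?\<tau>" using less len le by (intro nth_mem) simp
      then have "?\<tau> ! (m 0 - m j - 1) \<le> m 0" using set_blocks[of 0 c] by simp
      ultimately have "\<not> (\<forall>a \<in> set (take (m 0 - m j - 1) ?\<tau>). a < ?\<tau> ! (m 0 - m j - 1))"
        by (metis not_less)
      then show ?thesis using 3 by blast
    qed simp
  qed
  have "(\<Sum>k \<in> split_points ?\<tau>. F k) = (\<Sum>j\<le>c. F (m 0 - m j))" for F :: "nat \<Rightarrow> nat"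
    using split_points_blocks[of 0] by (simp add: sum.reindex[OF inj] atLeast0AtMost)
  note reindex = this
  show ?thesis
    unfolding card_occurrences_join132[OF assms] reindex
  proof (rule sum.cong[OF refl])
    fix j assume "j \<in> {..c}"
    then have j: "j \<le> c" by simp
    show "(card (occurrences (take (m 0 - m j) ?\<tau>) \<beta>) +
      (if m 0 - m j \<noteq> 0 \<and> (\<forall>a \<in> set (take (m 0 - m j - 1) ?\<tau>). a < ?\<tau> ! (m 0 - m j - 1))
       then card (occurrences (take (m 0 - m j - 1) ?\<tau>) \<beta>) else 0))
    * card (occurrences (drop (m 0 - m j) ?\<tau>) \<gamma>) = (card (occurrences (blocks m 0 j) \<beta>) +
        (if j = 1 then card (occurrences [Suc (m 1)..<m 0] \<beta>) else 0))
      * card (occurrences (blocks m j c) \<gamma>)"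
    proof (cases "j = 1")
      case True
      then show ?thesis
        unfolding greatest(1)[OF j] take[OF j] using greatest(2)[OF j True]
        by (simp only: True simp_thms if_True)
    next
      case False
      then show ?thesis unfolding greatest(1)[OF j] take[OF j] by (simp only: if_False)
    qed
  qed
qed

end


subsection \<open>Generating functions\<close>

text \<open>In the application \<open>N\<close> counts occurrences of longer and longer prefixes of the pattern and \<open>M\<close>
  those of shorter and shorter suffixes, so a sum equal to 1 has a single nonzero term, at which
  \<open>N\<close> vanishes next and \<open>M\<close> vanished before.\<close>

lemma of_bool_chain_sum_eq_1:
  fixes N M :: "nat \<Rightarrow> nat"
  assumes N: "\<And>j. j < K \<Longrightarrow> N j = 0 \<Longrightarrow> N (Suc j) = 0"
    and M: "\<And>j. j < K \<Longrightarrow> M (Suc j) = 0 \<Longrightarrow> M j = 0"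
  shows "(of_bool ((\<Sum>j\<le>K. N j * M j) = 1) :: real) =
    (\<Sum>j\<le>K. of_bool (N j = 1 \<and> (j = K \<or> N (Suc j) = 0)) * of_bool (M j = 1 \<and> (j = 0 \<or> M (j - 1) = 0)))"
proof -
  define Q where "Q j \<longleftrightarrow> N j = 1 \<and> (j = K \<or> N (Suc j) = 0) \<and> M j = 1 \<and> (j = 0 \<or> M (j - 1) = 0)" for j
  have N0: "N j = 0" if "i \<le> j" "j \<le> K" "N i = 0" for i j
    using that by (induction j rule: dec_induct) (use N in auto)
  have M0: "M i = 0" if "i \<le> j" "j \<le> K" "M j = 0" for i j
    using that by (induction i rule: inc_induct) (use M in auto)
  \<comment> \<open>Below \<open>j\<close> the zero \<open>M (j - 1) = 0\<close> spreads downwards,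
    above \<open>j\<close> the zero \<open>N (Suc j) = 0\<close> spreads upwards.\<close>
  have others: "N i * M i = 0" "\<not> Q i" if "Q j" "i \<noteq> j" "i \<le> K" "j \<le> K" for i j
  proof -
    consider "i < j" | "j < i" using \<open>i \<noteq> j\<close> by linarith
    then have "N i * M i = 0 \<and> \<not> Q i"
    proof cases
      case 1
      then have "M i = 0" using that M0[of i "j - 1"] by (auto simp: Q_def)
      then show ?thesis by (simp add: Q_def)
    next
      case 2
      then have "N i = 0" using that N0[of "Suc j" i] by (auto simp: Q_def)
      then show ?thesis by (simp add: Q_def)
    qed
    then show "N i * M i = 0" "\<not> Q i" by blast+
  qed
  have "(\<Sum>j\<le>K. N j * M j) = 1 \<longleftrightarrow> (\<exists>j\<le>K. Q j)"
  proof
    assume "(\<Sum>j\<le>K. N j * M j) = 1"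
    then have "\<exists>j \<in> {..K}. N j * M j = 1 \<and> (\<forall>i \<in> {..K}. j \<noteq> i \<longrightarrow> N i * M i = 0)"
      using sum_eq_1_iff[of "{..K}" "\<lambda>j. N j * M j"] by (simp only: finite_atMost)
    then obtain j where j: "j \<le> K" "N j * M j = 1" "\<forall>i \<le> K. j \<noteq> i \<longrightarrow> N i * M i = 0"
      by blast
    \<comment> \<open>The neighbouring term vanishes, and its factor \<open>M (Suc j)\<close> cannot
      be the reason because \<open>M j\<close> is nonzero.\<close>
    have "N (Suc j) = 0 \<or> j = K"
    proof (rule disjCI)
      assume that: "j \<noteq> K"
      have "j < K" using that j(1) by simp
      then have "N (Suc j) * M (Suc j) = 0" using j(3) by (metis Suc_leI n_not_Suc_n)
      moreover have "M (Suc j) \<noteq> 0" using M[OF \<open>j < K\<close>] j(2) by auto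
      ultimately show "N (Suc j) = 0" by simp
    qed
    moreover have "M (j - 1) = 0 \<or> j = 0"
    proof (rule disjCI)
      assume that: "j \<noteq> 0"
      have "j - 1 < K" "Suc (j - 1) = j" "j - 1 \<noteq> j" using that j(1) by simp_all
      then have "N (j - 1) * M (j - 1) = 0" using j(3) by (metis less_imp_le)
      moreover have "N (j - 1) \<noteq> 0" using N[OF \<open>j - 1 < K\<close>] \<open>Suc (j - 1) = j\<close> j(2) by auto
      ultimately show "M (j - 1) = 0" by simp
    qed
    moreover have "N j = 1" "M j = 1" using j(2) by simp_all
    ultimately have "Q j" by (auto simp: Q_def)
    then show "\<exists>j\<le>K. Q j" using j(1) by (intro exI[of _ j] conjI)
  next
    assume "\<exists>j\<le>K. Q j"
    then obtain j where j: "j \<le> K" "Q j" by blast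
    then have "N j * M j = 1" by (simp add: Q_def)
    then have "\<exists>j \<in> {..K}. N j * M j = 1 \<and> (\<forall>i \<in> {..K}. j \<noteq> i \<longrightarrow> N i * M i = 0)"
      using j(1) others(1)[OF j(2) _ _ j(1)] by (metis atMost_iff)
    then show "(\<Sum>j\<le>K. N j * M j) = 1"
      using sum_eq_1_iff[of "{..K}" "\<lambda>j. N j * M j"] by (simp only: finite_atMost)
  qed
  moreover have "(\<Sum>j\<le>K. of_bool (Q j)) = (of_bool (\<exists>j\<le>K. Q j) :: real)"
  proof (cases "\<exists>j\<le>K. Q j")
    case True
    then obtain j where j: "j \<le> K" "Q j" by blast
    then have "(\<Sum>i\<le>K. of_bool (Q i)) = (\<Sum>i\<le>K. if i = j then 1 else (0::real))"
      using others(2)[OF j(2)] by (intro sum.cong) auto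
    then show ?thesis using True j(1) by simp
  qed auto
  moreover have "of_bool (Q j) = of_bool (N j = 1 \<and> (j = K \<or> N (Suc j) = 0)) *
      (of_bool (M j = 1 \<and> (j = 0 \<or> M (j - 1) = 0)) :: real)" for j
    by (simp add: Q_def)
  ultimately show ?thesis by simp
qed

section \<open>Increasing patterns\<close>

lemma occurrences_map_add_pattern: "occurrences (map ((+) k) \<tau>) \<alpha> = occurrences \<tau> \<alpha>"
  by (rule occurrences_map_pattern) simp

lemma occurrences_upt_shift: "occurrences [k + a..<k + b] \<alpha> = occurrences [a..<b] \<alpha>"
proof -
  have "[k + a..<k + b] = map ((+) k) [a..<b]" by (rule nth_equalityI) simp_all
  then show ?thesis by (simp only: occurrences_map_add_pattern)
qed

lemma occurrences_upt_Suc_eq_empty: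
  assumes "a \<le> b" "occurrences [a..<b] \<alpha> = {}"
  shows "occurrences [a..<Suc b] \<alpha> = {}"
  using assms occurrences_append_eq_empty[of "[a..<b]" \<alpha> "[b]"] by simp

text \<open>Deleting the last or the first index of an occurrence of the longer pattern gives two
  occurrences of the shorter one. They differ in their first index, as \<open>a < b\<close> makes
  the shorter pattern nonempty.\<close>

lemma occurrences_upt_Suc_once:
  assumes "a < b" "card (occurrences [a..<b] \<alpha>) = 1"
  shows "occurrences [a..<Suc b] \<alpha> = {}"
proof (rule ccontr)
  assume "occurrences [a..<Suc b] \<alpha> \<noteq> {}"
  then obtain js where js: "js \<in> occurrences [a..<Suc b] \<alpha>" by blast
  have len: "length js = Suc b - a" using length_occurrence[OF js] by (simp del: upt_Suc)
  have "take (b - a) js \<in> occurrences [a..<b] \<alpha>"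
    using take_occurrence[OF js, of "b - a"] assms(1) by simp
  moreover have "drop 1 js \<in> occurrences [a..<b] \<alpha>"
    using drop_occurrence[OF js, of 1] occurrences_upt_shift[of 1 a b \<alpha>] by (simp del: upt_Suc)
  ultimately have "take (b - a) js = drop 1 js"
    using assms(2) by (metis card_1_singletonE singletonD)
  then have "take (b - a) js ! 0 = drop 1 js ! 0" by simp
  then have "js ! 0 = js ! 1" using len assms(1) by simp
  moreover have "sorted_wrt (<) js" using js by (simp add: occurrences_def)
  then have "js ! 0 < js ! 1" using sorted_wrt_nth_less[of "(<)" js 0 1] len assms(1) by simp
  ultimately show False by simp
qed

lemma occurrences_singleton_eq_empty_iff: "occurrences [a] \<alpha> = {} \<longleftrightarrow> \<alpha> = []"
proof
  have "[0] \<in> occurrences [a] \<alpha>" if "\<alpha> \<noteq> []"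
    using that by (simp add: occurrences_def order_isomorphic_def)
  then show "occurrences [a] \<alpha> = {} \<Longrightarrow> \<alpha> = []" by blast
qed (simp add: occurrences_word_Nil)

lemma av132_word_facts:
  assumes "\<alpha> \<in> av132 n"
  shows "set \<alpha> = {1..length \<alpha>}"
  using av132D[OF assms] by simp

text \<open>\<open>join132 \<beta> \<gamma>\<close> avoids the pattern of length
  \<open>p + 1\<close> iff \<open>\<beta>\<close> avoids the one of length \<open>p\<close> and
  \<open>\<gamma>\<close> the one of length \<open>p + 1\<close>. The resulting equation is the
  recurrence \<open>R_Suc\<close>, which has a unique solution.\<close>

lemma weight_fps_avoids_increasing:
  "weight_fps (\<lambda>\<alpha>. of_bool (avoids [1..<Suc p] \<alpha>)) = R p"
proof (induction p)
  case 0
  \<comment> \<open>The empty pattern occurs in every permutation, so nothing avoids it.\<close>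
  show ?case by (rule fps_ext) (simp add: weight_fps_def avoids_def occurrences_Nil R_zero)
next
  case (Suc p)
  let ?f = "\<lambda>\<alpha>. of_bool (avoids [1..<Suc (Suc p)] \<alpha>) :: real"
  let ?u = "\<lambda>\<alpha>. of_bool (avoids [1..<Suc p] \<alpha>) :: real"
  \<comment> \<open>The increasing pattern is treated as a layered pattern with one layer.\<close>
  let ?m = "\<lambda>i :: nat. if i = 0 then Suc p else 0"
  have dec: "?m (Suc i) < ?m i" if "i < 1" for i using that by simp
  have b: "blocks ?m 0 1 = [1..<Suc (Suc p)]" "blocks ?m 0 0 = []" "blocks ?m 1 1 = []"
    using blocks_Suc[of ?m 0] by (simp_all add: blocks_same)
  have avoid: "avoids [1..<Suc (Suc p)] \<beta>" if "avoids [1..<Suc p] \<beta>" for \<beta>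
    using occurrences_upt_Suc_eq_empty[of 1 "Suc p" \<beta>] that by (simp add: avoids_def)
  \<comment> \<open>The sum over a one-element set puts the single product into the form that
    \<open>weight_fps_join132\<close> expects.\<close>
  have "?f (join132 \<beta> \<gamma>) = (\<Sum>i \<in> {()}. ?u \<beta> * ?f \<gamma>)"
    if "\<beta> \<in> av132 k" "\<gamma> \<in> av132 l" for k l \<beta> \<gamma>
  proof -
    have "card (occurrences (blocks ?m 0 1) (join132 \<beta> \<gamma>)) =
      (\<Sum>j\<le>1. (card (occurrences (blocks ?m 0 j) \<beta>) +
        (if j = 1 then card (occurrences [Suc (?m 1)..<?m 0] \<beta>) else 0))
      * card (occurrences (blocks ?m j 1) \<gamma>))"
    proof (rule card_occurrences_blocks_join132[of 1 ?m])
      show "?m (Suc i) < ?m i" if "i < 1" for i using dec that .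
      show "set \<beta> = {1..length \<beta>}" "set \<gamma> = {1..length \<gamma>}"
        using that av132_word_facts by blast+
    qed
    also have "\<dots> = card (occurrences [1..<Suc (Suc p)] \<gamma>) +
      (card (occurrences [1..<Suc (Suc p)] \<beta>) + card (occurrences [1..<Suc p] \<beta>))"
      using b by (simp add: occurrences_Nil del: upt_Suc)
    finally have "avoids [1..<Suc (Suc p)] (join132 \<beta> \<gamma>) \<longleftrightarrow>
        avoids [1..<Suc p] \<beta> \<and> avoids [1..<Suc (Suc p)] \<gamma>"
      using avoid[of \<beta>] unfolding b avoids_iff_card by auto
    then show ?thesis by simp
  qed
  then have "weight_fps ?f = fps_const (?f []) + fps_X * (\<Sum>i \<in> {()}. weight_fps ?u * weight_fps ?f)"
    by (rule weight_fps_join132)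
  also have "?f [] = 1" by (simp add: avoids_def occurrences_word_Nil)
  finally have "weight_fps ?f * (1 - fps_X * R p) = 1"
    unfolding Suc.IH by (simp add: algebra_simps)
  moreover have "R (Suc p) * (1 - fps_X * R p) = 1" by (rule R_Suc)
  ultimately have "weight_fps ?f * (1 - fps_X * R p) = R (Suc p) * (1 - fps_X * R p)"
    and "1 - fps_X * R p \<noteq> 0" by auto
  then show ?case using mult_right_cancel by blast
qed

section \<open>The series of the theorem as weighted generating functions\<close>

lemma G_eq_weight_fps: "G \<tau> = weight_fps (\<lambda>\<alpha>. of_bool (contains_once \<tau> \<alpha>))"
proof -
  have "{\<alpha> \<in> permutations_of_set {1..n}. avoids [1,3,2] \<alpha> \<and> contains_once \<tau> \<alpha>} =
      av132 n \<inter> {\<alpha>. contains_once \<tau> \<alpha>}" for n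
    by (auto simp: av132_def)
  then show ?thesis by (simp only: G_def g_def weight_fps_def) (simp add: finite_av132)
qed

lemma G_avoid_eq_weight_fps:
  assumes "\<tau> \<noteq> []"
  shows "G_avoid \<rho> \<tau> = weight_fps (\<lambda>\<alpha>. of_bool (contains_once \<tau> \<alpha> \<and> avoids \<rho> \<alpha>))"
proof -
  have "{\<alpha> \<in> permutations_of_set {1..n}. avoids [1,3,2] \<alpha> \<and> avoids \<rho> \<alpha> \<and> contains_once \<tau> \<alpha>} =
      av132 n \<inter> {\<alpha>. contains_once \<tau> \<alpha> \<and> avoids \<rho> \<alpha>}" for n
    by (auto simp: av132_def)
  then show ?thesis
    using assms by (simp only: G_avoid_def g_avoid_def weight_fps_def if_False) (simp add: finite_av132)
qed

text \<open>This produces the conventional value 1 of \<open>G_avoid\<close> at the empty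
  pattern.\<close>

lemma weight_fps_Nil: "weight_fps (\<lambda>\<alpha>. of_bool (\<alpha> = [])) = 1"
proof (rule fps_ext)
  fix n
  show "weight_fps (\<lambda>\<alpha>. of_bool (\<alpha> = [])) $ n = 1 $ n"
  proof (cases "n = 0")
    case False
    then have "[] \<notin> av132 n" using av132D(3)[of "[]" n] by auto
    then show ?thesis using False by (simp add: weight_fps_def finite_av132)
  qed (simp add: weight_fps_def av132_0)
qed

theorem theorem3p3:
  fixes r :: nat and m :: "nat \<Rightarrow> nat" and d :: "nat \<Rightarrow> nat \<Rightarrow> nat"
  assumes "r \<ge> 1"
    and "\<And>i. i \<le> r \<Longrightarrow> m i > m (Suc i)"
    and "m (Suc r) = 0"
    and "\<And>i j. d i j = m i - m j"
  shows "(1 - fps_X * R (d 0 1 - 1) - fps_X * R (m r)) * G (layered (map m [0..<Suc r])) =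
      fps_X * G_avoid (layered [d 0 2, d 1 2]) (layered [d 0 1 - 1])
            * G_avoid (layered (map m [0..<Suc r])) (layered (map m [1..<Suc r]))
    + fps_X * (\<Sum>j = 2..r.
          G_avoid (layered (map (\<lambda>i. d i (Suc j)) [0..<Suc j])) (layered (map (\<lambda>i. d i j) [0..<j]))
        * G_avoid (layered (map m [j - 1..<Suc r])) (layered (map m [j..<Suc r])))"
proof -
  define K where "K = Suc r"
  have dec: "m (Suc i) < m i" if "i < K" for i using assms(2)[of i] that by (simp add: K_def)
  note le = decr_le[of K m, OF dec] and less = decr_less[of K m, OF dec]
  have mK: "m K = 0" using assms(3) by (simp add: K_def)
  have d: "d = (\<lambda>i j. m i - m j)" using assms(4) by (intro ext) simp

  \<comment> \<open>Translation of the layered patterns into blocks\<close>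
  have suffix: "layered (map m [j..<Suc r]) = blocks m j K" "layered (map m [j..<Suc r]) \<noteq> []"
    if "j \<le> r" for j
  proof -
    show 1: "layered (map m [j..<Suc r]) = blocks m j K"
      unfolding K_def using that assms(3) by (intro layered_eq_blocks) simp_all
    have "length (blocks m j K) > 0"
      using length_blocks[of K m j K, OF dec] less[of j K] that mK by (simp add: K_def)
    then show "layered (map m [j..<Suc r]) \<noteq> []" unfolding 1 by simp
  qed
  have pre: "occurrences (layered (map (\<lambda>i. d i j) [0..<j])) = occurrences (blocks m 0 j)"
      "layered (map (\<lambda>i. d i j) [0..<j]) \<noteq> []"
    if "0 < j" "j \<le> K" for j
  proof -
    have 1: "layered (map (\<lambda>i. d i j) [0..<j]) = blocks (\<lambda>i. m i - m j) 0 j"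
      unfolding d using that by (intro layered_eq_blocks) simp_all
    have 2: "map ((+) (m j)) (blocks (\<lambda>i. m i - m j) 0 j) = blocks m 0 j"
      using le that by (intro map_add_blocks_diff) simp
    show "occurrences (layered (map (\<lambda>i. d i j) [0..<j])) = occurrences (blocks m 0 j)"
      unfolding 1 using occurrences_map_add_pattern[of "m j" "blocks (\<lambda>i. m i - m j) 0 j"]
      unfolding 2 by (intro ext) simp
    have "length (blocks m 0 j) > 0"
      using length_blocks[of K m 0 j, OF dec] less[of 0 j] that by simp
    then show "layered (map (\<lambda>i. d i j) [0..<j]) \<noteq> []" unfolding 1 2[symmetric] by simp
  qed
  have pre2: "occurrences (layered [d 0 2, d 1 2]) = occurrences (blocks m 0 2)"
    using pre(1)[of 2] assms(1) by (simp add: K_def eval_nat_numeral)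
  \<comment> \<open>\<open>[d 0 1 - 1]\<close> is the first layer without its last letter; it is
    empty exactly when that layer has length one.\<close>
  have pre1: "occurrences (layered [d 0 1 - 1]) = occurrences [Suc (m 1)..<m 0]"
    "layered [d 0 1 - 1] = [] \<longleftrightarrow> m 0 = Suc (m 1)"
    using occurrences_upt_shift[of "m 1" 1 "Suc (d 0 1 - 1)"] dec[of 0]
    by (auto simp: d K_def fun_eq_iff simp del: upt_Suc)
  have blocks01: "blocks m 0 1 = [Suc (m 1)..<Suc (m 0)]"
    using blocks_Suc[of m 0] by simp
  have blocks_last: "blocks m r K = [1..<Suc (m r)]"
    using blocks_Suc[of m r] mK by (simp add: K_def)

  \<comment> \<open>The functional equation from the decomposition\<close>
  define N where "N j \<beta> = card (occurrences (blocks m 0 j) \<beta>) +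
    (if j = 1 then card (occurrences [Suc (m 1)..<m 0] \<beta>) else 0)" for j \<beta>
  define M where "M j \<gamma> = card (occurrences (blocks m j K) \<gamma>)" for j \<gamma>
  \<comment> \<open>\<open>u j\<close> and \<open>v j\<close> mark the two halves of the only
    nonzero term; at the ends \<open>j = K\<close> and \<open>j = 0\<close> there is no neighbour
    that has to vanish.\<close>
  define u :: "nat \<Rightarrow> nat list \<Rightarrow> real" where
    "u j \<beta> = of_bool (N j \<beta> = 1 \<and> (j = K \<or> N (Suc j) \<beta> = 0))" for j \<beta>
  define v :: "nat \<Rightarrow> nat list \<Rightarrow> real" where
    "v j \<gamma> = of_bool (M j \<gamma> = 1 \<and> (j = 0 \<or> M (j - 1) \<gamma> = 0))" for j \<gamma>
  let ?f = "\<lambda>\<alpha>. of_bool (contains_once (blocks m 0 K) \<alpha>) :: real"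

  have N0: "N 0 \<beta> = 1" for \<beta> by (simp add: N_def blocks_same occurrences_Nil)
  have N_Suc: "N (Suc j) \<beta> = 0" if "j < K" "N j \<beta> = 0" for j \<beta>
  proof -
    \<comment> \<open>This rules out \<open>Suc j = 1\<close>, the one index at which
      \<open>N\<close> has its extra summand.\<close>
    have "j \<noteq> 0" using that(2) N0 by (metis zero_neq_one)
    moreover have "occurrences (blocks m 0 (Suc j)) \<beta> = {}"
      using that occurrences_append_eq_empty[of "blocks m 0 j" \<beta> "blocks m j (Suc j)"]
        blocks_append[of 0 j "Suc j" m] by (simp add: N_def finite_occurrences)
    ultimately show ?thesis by (simp add: N_def)
  qed
  have M_Suc: "M j \<gamma> = 0" if "j < K" "M (Suc j) \<gamma> = 0" for j \<gamma>
    using that occurrences_append_eq_empty[of "blocks m j (Suc j)" \<gamma> "blocks m (Suc j) K"]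
      blocks_append[of j "Suc j" K m] by (simp add: M_def finite_occurrences)
  have join: "?f (join132 \<beta> \<gamma>) = (\<Sum>j\<le>K. u j \<beta> * v j \<gamma>)"
    if "\<beta> \<in> av132 k" "\<gamma> \<in> av132 l" for k l \<beta> \<gamma>
  proof -
    have "card (occurrences (blocks m 0 K) (join132 \<beta> \<gamma>)) = (\<Sum>j\<le>K. N j \<beta> * M j \<gamma>)"
      unfolding N_def M_def
    proof (rule card_occurrences_blocks_join132[of K m])
      show "m (Suc i) < m i" if "i < K" for i using dec that .
      show "set \<beta> = {1..length \<beta>}" "set \<gamma> = {1..length \<gamma>}"
        using that av132_word_facts by blast+
    qed
    moreover have "of_bool ((\<Sum>j\<le>K. N j \<beta> * M j \<gamma>) = 1) = (\<Sum>j\<le>K. u j \<beta> * v j \<gamma>)"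
      unfolding u_def v_def
      by (rule of_bool_chain_sum_eq_1) (use N_Suc M_Suc in blast)+
    ultimately show ?thesis by (simp only: contains_once_def)
  qed
  have "blocks m 0 K \<noteq> []" using suffix[of 0] by simp
  then have "?f [] = 0" by (simp add: contains_once_def occurrences_word_Nil)
  moreover have "weight_fps ?f = fps_const (?f []) + fps_X * (\<Sum>j\<le>K. weight_fps (u j) * weight_fps (v j))"
    by (rule weight_fps_join132) (rule join)
  ultimately have main: "weight_fps ?f = fps_X * (\<Sum>j\<le>K. weight_fps (u j) * weight_fps (v j))"
    by (simp only: fps_const_0_eq_0 add_0)

  \<comment> \<open>Identification of the factors\<close>
  have G: "weight_fps ?f = G (layered (map m [0..<Suc r]))"
    by (simp only: G_eq_weight_fps suffix(1)[OF le0])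
  have N1: "N 1 \<beta> = card (occurrences [Suc (m 1)..<Suc (m 0)] \<beta>) +
      card (occurrences [Suc (m 1)..<m 0] \<beta>)" for \<beta>
    by (simp only: N_def blocks01 if_True simp_thms)
  have N2: "N (Suc 1) \<beta> = card (occurrences (blocks m 0 2) \<beta>)" for \<beta>
    by (simp add: N_def numeral_2_eq_2)
  \<comment> \<open>An occurrence of the full first layer contains one of the shortened layer, so
    only the latter needs to be excluded.\<close>
  have P0: "N 1 \<beta> = 0 \<longleftrightarrow> occurrences [Suc (m 1)..<m 0] \<beta> = {}" for \<beta>
    using occurrences_upt_Suc_eq_empty[of "Suc (m 1)" "m 0" \<beta>] dec[of 0]
    unfolding N1 by (auto simp: finite_occurrences K_def simp del: upt_Suc)

  \<comment> \<open>Since \<open>N 0\<close> is always 1, only the condition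
    \<open>N 1 \<beta> = 0\<close> remains.\<close>
  have "u 0 = (\<lambda>\<beta>. of_bool (avoids [1..<Suc (d 0 1 - 1)] \<beta>))"
  proof
    fix \<beta>
    have "occurrences [1..<Suc (d 0 1 - 1)] \<beta> = occurrences [Suc (m 1)..<m 0] \<beta>"
      using pre1(1) by simp
    then show "u 0 \<beta> = of_bool (avoids [1..<Suc (d 0 1 - 1)] \<beta>)"
      using N0[of \<beta>] P0[of \<beta>] by (simp add: u_def avoids_def K_def del: upt_Suc)
  qed
  then have u0: "weight_fps (u 0) = R (d 0 1 - 1)"
    by (simp only: weight_fps_avoids_increasing)
  have v0: "weight_fps (v 0) = G (layered (map m [0..<Suc r]))"
    unfolding G[symmetric] by (simp add: v_def[abs_def] M_def contains_once_def)
  have u1: "weight_fps (u 1) = G_avoid (layered [d 0 2, d 1 2]) (layered [d 0 1 - 1])"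
  proof (cases "m 0 = Suc (m 1)")
    \<comment> \<open>The shortened layer is empty and contributes one occurrence by itself, so
      \<open>N 1 \<beta> = 1\<close> forces \<open>\<beta>\<close> to be empty. This agrees with the
      convention for the empty pattern.\<close>
    case True
    have "u 1 \<beta> = of_bool (\<beta> = [])" for \<beta>
    proof -
      have "N 1 \<beta> = Suc (card (occurrences [m 0] \<beta>))"
        unfolding N1 True by (simp add: occurrences_Nil)
      then have *: "N 1 \<beta> = 1 \<longleftrightarrow> \<beta> = []"
        using occurrences_singleton_eq_empty_iff[of "m 0" \<beta>] by (simp add: finite_occurrences)
      have "blocks m 0 2 \<noteq> []"
        using length_blocks[of K m 0 2, OF dec] less[of 0 2] assms(1) by (auto simp: K_def)
      then have "N (Suc 1) [] = 0" unfolding N2 by (simp add: occurrences_word_Nil)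
      then show ?thesis unfolding u_def * by auto
    qed
    then have "weight_fps (u 1) = 1" using weight_fps_Nil by (simp add: weight_fps_def)
    moreover have "layered [d 0 1 - 1] = []" using pre1(2) True by blast
    ultimately show ?thesis by (simp only: G_avoid_def refl if_True)
  next
    \<comment> \<open>With at most one occurrence of the shortened layer there is none of the full
      layer, so the sum of the two counts is 1 exactly when the shortened layer occurs once.\<close>
    case False
    have "u 1 \<beta> = of_bool (contains_once (layered [d 0 1 - 1]) \<beta> \<and> avoids (layered [d 0 2, d 1 2]) \<beta>)" for \<beta>
    proof -
      have lt: "Suc (m 1) < m 0" using False dec[of 0] by (simp add: K_def)
      define P where "P = card (occurrences [Suc (m 1)..<m 0] \<beta>)"
      define Q where "Q = card (occurrences [Suc (m 1)..<Suc (m 0)] \<beta>)"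
      have "P = 1 \<Longrightarrow> Q = 0"
        using occurrences_upt_Suc_once[OF lt, of \<beta>] by (simp add: P_def Q_def del: upt_Suc)
      moreover have "P = 0 \<Longrightarrow> Q = 0"
        using occurrences_upt_Suc_eq_empty[of "Suc (m 1)" "m 0" \<beta>] lt
        by (simp add: P_def Q_def finite_occurrences del: upt_Suc)
      moreover have "N 1 \<beta> = Q + P" by (simp only: N1 P_def Q_def)
      ultimately have "N 1 \<beta> = 1 \<longleftrightarrow> P = 1" by presburger
      moreover have "N (Suc 1) \<beta> = 0 \<longleftrightarrow> avoids (layered [d 0 2, d 1 2]) \<beta>"
        by (simp only: avoids_iff_card pre2 N2)
      moreover have "1 \<noteq> K" using assms(1) by (simp add: K_def)
      ultimately show ?thesis unfolding u_def contains_once_def pre1(1) P_def by simp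
    qed
    then show ?thesis using False pre1(2) by (simp add: G_avoid_eq_weight_fps weight_fps_def)
  qed
  have vj: "weight_fps (v j) = G_avoid (layered (map m [j - 1..<Suc r])) (layered (map m [j..<Suc r]))"
    if "1 \<le> j" "j \<le> r" for j
  proof -
    have "j - 1 \<le> r" "j \<noteq> 0" using that by simp_all
    have "blocks m j K \<noteq> []" using suffix[OF that(2)] by simp
    then show ?thesis
      unfolding suffix(1)[OF that(2)] suffix(1)[OF \<open>j - 1 \<le> r\<close>] using \<open>j \<noteq> 0\<close>
      by (simp add: G_avoid_eq_weight_fps v_def[abs_def] M_def contains_once_def avoids_iff_card)
  qed
  \<comment> \<open>From \<open>j = 2\<close> on the largest letter cannot be used, so
    \<open>N j\<close> and \<open>N (Suc j)\<close> count plain prefixes, which are the patterns in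
    the differences shifted upwards.\<close>
  have uj: "weight_fps (u j) = G_avoid (layered (map (\<lambda>i. d i (Suc j)) [0..<Suc j]))
      (layered (map (\<lambda>i. d i j) [0..<j]))" if "2 \<le> j" "j \<le> r" for j
  proof -
    have j: "0 < j" "j \<le> K" "0 < Suc j" "Suc j \<le> K" "j \<noteq> 1" "j \<noteq> K" "Suc j \<noteq> 1"
      using that by (simp_all add: K_def)
    show ?thesis
      unfolding G_avoid_eq_weight_fps[OF pre(2)[OF j(1,2)]] contains_once_def avoids_iff_card
        pre(1)[OF j(1,2)] pre(1)[OF j(3,4)] u_def[abs_def] N_def
      using j by simp
  qed
  \<comment> \<open>All layers lie in the first factor; \<open>r \<ge> 1\<close> gives
    \<open>K \<noteq> 1\<close>, so \<open>N K\<close> has no extra summand.\<close>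
  have uK: "weight_fps (u (Suc r)) = G (layered (map m [0..<Suc r]))"
    unfolding G[symmetric] using assms(1)
    by (simp add: u_def[abs_def] N_def contains_once_def K_def)
  \<comment> \<open>The empty suffix occurs once in every word, so \<open>v (Suc r)\<close> only
    demands that the last layer be avoided.\<close>
  have "v (Suc r) = (\<lambda>\<gamma>. of_bool (avoids [1..<Suc (m r)] \<gamma>))"
    unfolding v_def[abs_def] M_def avoids_iff_card K_def[symmetric] blocks_same occurrences_Nil
    by (simp add: K_def blocks_last[unfolded K_def] del: upt_Suc)
  then have vK: "weight_fps (v (Suc r)) = R (m r)"
    by (simp only: weight_fps_avoids_increasing)
  let ?S = "\<lambda>j. weight_fps (u j) * weight_fps (v j)"
  have "{..K} = {0, 1} \<union> {2..r} \<union> {Suc r}" using assms(1) by (auto simp: K_def)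
  then have "(\<Sum>j\<le>K. ?S j) = ?S 0 + ?S 1 + (\<Sum>j = 2..r. ?S j) + ?S (Suc r)"
    using assms(1) by (simp add: sum.union_disjoint add.assoc)
  also have "(\<Sum>j = 2..r. ?S j) = (\<Sum>j = 2..r.
          G_avoid (layered (map (\<lambda>i. d i (Suc j)) [0..<Suc j])) (layered (map (\<lambda>i. d i j) [0..<j]))
        * G_avoid (layered (map m [j - 1..<Suc r])) (layered (map m [j..<Suc r])))"
    by (intro sum.cong refl arg_cong2[where f = "(*)"] uj vj) auto
  finally have "(\<Sum>j\<le>K. ?S j) = R (d 0 1 - 1) * G (layered (map m [0..<Suc r]))
      + G_avoid (layered [d 0 2, d 1 2]) (layered [d 0 1 - 1])
            * G_avoid (layered (map m [0..<Suc r])) (layered (map m [1..<Suc r]))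
      + (\<Sum>j = 2..r.
          G_avoid (layered (map (\<lambda>i. d i (Suc j)) [0..<Suc j])) (layered (map (\<lambda>i. d i j) [0..<j]))
        * G_avoid (layered (map m [j - 1..<Suc r])) (layered (map m [j..<Suc r])))
      + G (layered (map m [0..<Suc r])) * R (m r)"
    using vj[of 1] assms(1) unfolding u0 v0 u1 uK vK by (simp only: diff_self_eq_0 order_refl)
  \<comment> \<open>The terms with index 0 and \<open>Suc r\<close> are multiples of the series
    sought and move to the left-hand side.\<close>
  from main[unfolded G this] show ?thesis by (simp only: algebra_simps) (simp add: algebra_simps)
qed

end
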